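(* Let $\Omega\subset\mathbb{C}$ be a hyperbolic domain satisfying Condition 2. Then $\Omega$ is a visibility domain.
   Context: Condition 2. $\mathbb{D}$ is the open unit disc. For distinct $x_1,x_2\in\partial\mathbb{D}$ (different from $1$), $Arc(x_1,x_2)$ and $Arc[x_1,x_2]$ denote the open and closed arcs of $\partial\mathbb{D}$ joining $x_1$ and $x_2$ and containing $1$; $[x_1,x_2]_p$ is the Poincaré (hyperbolic) geodesic line in $\mathbb{D}$ with endpoints $x_1,x_2$, together with these endpoints; $Reg(x_1,x_2)$ is the open region bounded by $Arc[x_1,x_2]$ and $[x_1,x_2]_p$. A hyperbolic domain $\Omega\subset\mathbb{C}$ satisfies Condition 2 if there exists a closed, totally disconnected set $S\subset\partial\Omega$ such that for every $p\in\partial\Omega\setminus S$ and every sequence $(z_n)_{n\ge1}$ in $\Omega$ with $z_n\to p$, there exist a subsequence $(z_{k_n})_{n\ge1}$, an injective holomorphic map $\phi:\mathbb{D}\to\Omega$ that extends continuously to $\overline{\mathbb{D}}$, and an arc $Arc(x_1,x_2)$ containing $1$ such that (1) $\phi(1)=p$ and $\phi(Arc(x_1,x_2))\subset\partial\Omega$; (2) $z_{k_n}\in\phi(Reg(x_1,x_2))$ for all $n$, and $\phi^{-1}(z_{k_n})\to1$ as $n\to\infty$. Visibility. $\partial\Omega$ is the boundary in $\mathbb{C}$. For a domain $\Omega\subset\mathbb{C}$, $\mathsf{k}_\Omega$ is the Kobayashi (pseudo)distance and $\kappa_\Omega(z;v)$ the Kobayashi--Royden (pseudo)metric; $\Omega$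 is hyperbolic if $\mathsf{k}_\Omega$ is a distance (in the plane, $\mathsf{k}_\Omega$ is then the hyperbolic distance). For $\lambda\ge1,\kappa\ge0$ and an interval $I\subset\mathbb{R}$, a map $\sigma:I\to\Omega$ is a $(\lambda,\kappa)$-almost-geodesic if (i) $\frac1\lambda|s-t|-\kappa\le \mathsf{k}_\Omega(\sigma(s),\sigma(t))\le\lambda|s-t|+\kappa$ for all $s,t\in I$; (ii) $\sigma$ is absolutely continuous and $\kappa_\Omega(\sigma(t);\sigma'(t))\le\lambda$ for a.e. $t\in I$. End compactification: if $\Omega$ is bounded, $\overline{\Omega}^{End}:=\overline{\Omega}$. If $\Omega$ is unbounded, fix an exhaustion $(K_j)_{j\ge1}$ of $\overline\Omega$ by compact sets with $K_j$ contained in the interior (in $\overline\Omega$) of $K_{j+1}$. An end of $\overline\Omega$ is a sequence $(F_j)_{j\ge1}$ with $F_j$ a connected component of $\overline\Omega\setminus K_j$ and $F_{j+1}\subset F_j$. As a set, $\overline{\Omega}^{End}$ is $\overline\Omega$ together with all ends. Points of $\overline\Omega$ have their Euclidean neighbourhoods in $\overline\Omega$ as neighbourhood basis; an end $(F_j)_j$ has the neighbourhood basis $(\widehat F_j)_j$, where $\widehat F_j$ is $F_j$ together with all ends $(G_\nu)_\nu$ with $G_\nu=F_\nu$ for $\nu=1,\dots,j$. (Up to natural homeomorphism this does not depend on the exhaustion.) $\partial\overline{\Omega}^{End}:=\overline{\Omega}^{End}\setminus\Omega$. Distinct $\zeta,\eta\in\partial\overline{\Omega}^{End}$ satisfy the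 $(\lambda,\kappa)$-visibility property if there exist neighbourhoods $V_\zeta$, $V_\eta$ of $\zeta,\eta$ in $\overline{\Omega}^{End}$ with $\overline{V_\zeta}\cap\overline{V_\eta}=\emptyset$ and a compact $K\subset\Omega$ such that every $(\lambda,\kappa)$-almost-geodesic $\sigma:[0,T]\to\Omega$ with $\sigma(0)\in V_\zeta$, $\sigma(T)\in V_\eta$ satisfies $\sigma([0,T])\cap K\ne\emptyset$. A hyperbolic domain $\Omega$ is a visibility domain if for all $\lambda\ge1$ and $\kappa>0$ every pair of distinct points of $\partial\overline{\Omega}^{End}$ satisfies the $(\lambda,\kappa)$-visibility property. *)

theory Defs
  imports "HOL-Complex_Analysis.Complex_Analysis"
begin

section \<open>Kobayashi distance and metric of a plane domain\<close>

text \<open>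
  Normalisation: curvature \<open>-4\<close>, i.e. line element \<open>|dz| / (1 - |z|\<^sup>2)\<close> on the unit disc, so that
  the distance below and the Kobayashi--Royden metric agree infinitesimally.
\<close>

definition poincare_dist :: "complex \<Rightarrow> complex \<Rightarrow> real" where
  "poincare_dist z w = artanh (cmod (Moebius_function 0 w z))"

text \<open>\<open>disc_chain \<Omega> z w l\<close>: a finite chain of analytic discs in \<open>\<Omega>\<close> of total length \<open>l\<close> joins
  \<open>z\<close> to \<open>w\<close>.\<close>

inductive disc_chain :: "complex set \<Rightarrow> complex \<Rightarrow> complex \<Rightarrow> real \<Rightarrow> bool" for \<Omega> where
  single: "\<lbrakk>f holomorphic_on ball 0 1; f ` ball 0 1 \<subseteq> \<Omega>; a \<in> ball 0 1; b \<in> ball 0 1\<rbrakk>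
    \<Longrightarrow> disc_chain \<Omega> (f a) (f b) (poincare_dist a b)"
| step: "\<lbrakk>f holomorphic_on ball 0 1; f ` ball 0 1 \<subseteq> \<Omega>; a \<in> ball 0 1; b \<in> ball 0 1;
      disc_chain \<Omega> (f b) w l\<rbrakk>
    \<Longrightarrow> disc_chain \<Omega> (f a) w (poincare_dist a b + l)"

definition kobayashi_dist :: "complex set \<Rightarrow> complex \<Rightarrow> complex \<Rightarrow> real" where
  "kobayashi_dist \<Omega> z w = Inf {l. disc_chain \<Omega> z w l}"

definition kobayashi_royden :: "complex set \<Rightarrow> complex \<Rightarrow> complex \<Rightarrow> real" where
  "kobayashi_royden \<Omega> z v = Inf {cmod \<alpha> |\<alpha>. \<exists>f. f holomorphic_on ball 0 1 \<and>
     f ` ball 0 1 \<subseteq> \<Omega> \<and> f 0 = z \<and> deriv f 0 * \<alpha> = v}"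

text \<open>On a domain, \<open>kobayashi_dist\<close> is always a pseudodistance, so that being a distance only
  asks for separation of points.\<close>

definition hyperbolic_domain :: "complex set \<Rightarrow> bool" where
  "hyperbolic_domain \<Omega> \<longleftrightarrow> open \<Omega> \<and> connected \<Omega> \<and> \<Omega> \<noteq> {} \<and>
     (\<forall>z\<in>\<Omega>. \<forall>w\<in>\<Omega>. kobayashi_dist \<Omega> z w = 0 \<longrightarrow> z = w)"


section \<open>Condition 2\<close>

definition totally_disconnected :: "'a::topological_space set \<Rightarrow> bool" where
  "totally_disconnected S \<longleftrightarrow> (\<forall>x\<in>S. connected_component_set S x = {x})"

definition open_arc :: "complex \<Rightarrow> complex \<Rightarrow> complex set" where
  "open_arc x1 x2 = connected_component_set (sphere 0 1 - {x1, x2}) 1"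

definition closed_arc :: "complex \<Rightarrow> complex \<Rightarrow> complex set" where
  "closed_arc x1 x2 = open_arc x1 x2 \<union> {x1, x2}"

definition poincare_geodesic_line :: "complex \<Rightarrow> complex \<Rightarrow> (real \<Rightarrow> complex) \<Rightarrow> bool" where
  "poincare_geodesic_line x1 x2 \<gamma> \<longleftrightarrow>
     range \<gamma> \<subseteq> ball 0 1 \<and> (\<forall>s t. poincare_dist (\<gamma> s) (\<gamma> t) = \<bar>s - t\<bar>) \<and>
     (\<gamma> \<longlongrightarrow> x1) at_bot \<and> (\<gamma> \<longlongrightarrow> x2) at_top"

text \<open>The geodesic line between two given boundary points is unique up to its parametrisation;
  the union over all of them is its trace.\<close>

definition closed_geodesic :: "complex \<Rightarrow> complex \<Rightarrow> complex set" where
  "closed_geodesic x1 x2 = (\<Union>{range \<gamma> |\<gamma>. poincare_geodesic_line x1 x2 \<gamma>}) \<union> {x1, x2}"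

text \<open>The union of the closed arc and the closed geodesic is a Jordan curve.\<close>

definition arc_region :: "complex \<Rightarrow> complex \<Rightarrow> complex set" where
  "arc_region x1 x2 = inside (closed_arc x1 x2 \<union> closed_geodesic x1 x2)"

text \<open>Below, \<open>\<phi>\<close> stands for the continuous extension of the map to the closed disc; injectivity
  is only required on the open disc, and the inverse is that of the map on the open disc.\<close>

definition condition2 :: "complex set \<Rightarrow> bool" where
  "condition2 \<Omega> \<longleftrightarrow>
     (\<exists>S. closed S \<and> totally_disconnected S \<and> S \<subseteq> frontier \<Omega> \<and>
       (\<forall>p \<in> frontier \<Omega> - S. \<forall>z::nat \<Rightarrow> complex. range z \<subseteq> \<Omega> \<and> z \<longlonglongrightarrow> p \<longrightarrow>
         (\<exists>(k::nat \<Rightarrow> nat) \<phi> x1 x2.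
            strict_mono k \<and>
            continuous_on (cball 0 1) \<phi> \<and> \<phi> holomorphic_on ball 0 1 \<and>
            inj_on \<phi> (ball 0 1) \<and> \<phi> ` ball 0 1 \<subseteq> \<Omega> \<and>
            x1 \<in> sphere 0 1 \<and> x2 \<in> sphere 0 1 \<and> x1 \<noteq> x2 \<and> x1 \<noteq> 1 \<and> x2 \<noteq> 1 \<and>
            \<phi> 1 = p \<and> \<phi> ` open_arc x1 x2 \<subseteq> frontier \<Omega> \<and>
            (\<forall>n. z (k n) \<in> \<phi> ` arc_region x1 x2) \<and>
            (\<lambda>n. inv_into (ball 0 1) \<phi> (z (k n))) \<longlonglongrightarrow> 1)))"


section \<open>Almost-geodesics\<close>

text \<open>In \<open>d division_of \<Union>d\<close>, \<open>d\<close> is a finite family of compact intervals with pairwise disjoint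
  interiors.\<close>

definition absolutely_continuous_on :: "real set \<Rightarrow> (real \<Rightarrow> complex) \<Rightarrow> bool" where
  "absolutely_continuous_on I f \<longleftrightarrow>
     (\<forall>\<epsilon>>0. \<exists>\<delta>>0. \<forall>d. d division_of \<Union>d \<and> \<Union>d \<subseteq> I \<and> (\<Sum>J\<in>d. Sup J - Inf J) < \<delta> \<longrightarrow>
        (\<Sum>J\<in>d. cmod (f (Sup J) - f (Inf J))) < \<epsilon>)"

definition almost_geodesic ::
  "complex set \<Rightarrow> real \<Rightarrow> real \<Rightarrow> real set \<Rightarrow> (real \<Rightarrow> complex) \<Rightarrow> bool" where
  "almost_geodesic \<Omega> \<Lambda> \<kappa> I \<sigma> \<longleftrightarrow>
     is_interval I \<and> \<sigma> ` I \<subseteq> \<Omega> \<and>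
     (\<forall>s\<in>I. \<forall>t\<in>I. 1 / \<Lambda> * \<bar>s - t\<bar> - \<kappa> \<le> kobayashi_dist \<Omega> (\<sigma> s) (\<sigma> t) \<and>
        kobayashi_dist \<Omega> (\<sigma> s) (\<sigma> t) \<le> \<Lambda> * \<bar>s - t\<bar> + \<kappa>) \<and>
     absolutely_continuous_on I \<sigma> \<and>
     (AE t in lebesgue. t \<in> I \<longrightarrow>
        (\<exists>v. (\<sigma> has_vector_derivative v) (at t within I) \<and> kobayashi_royden \<Omega> (\<sigma> t) v \<le> \<Lambda>))"


section \<open>End compactification\<close>

definition compact_exhaustion :: "'a::topological_space set \<Rightarrow> (nat \<Rightarrow> 'a set) \<Rightarrow> bool" where
  "compact_exhaustion X K \<longleftrightarrow>
     (\<forall>j. compact (K j) \<and> K j \<subseteq> top_of_set X interior_of K (Suc j)) \<and> (\<Union>j. K j) = X"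

definition ends :: "complex set \<Rightarrow> (nat \<Rightarrow> complex set) \<Rightarrow> (nat \<Rightarrow> complex set) set" where
  "ends \<Omega> K = (if bounded \<Omega> then {}
     else {F. \<forall>j. F j \<in> components (closure \<Omega> - K j) \<and> F (Suc j) \<subseteq> F j})"

datatype end_point = Pt complex | End "nat \<Rightarrow> complex set"

definition end_carrier :: "complex set \<Rightarrow> (nat \<Rightarrow> complex set) \<Rightarrow> end_point set" where
  "end_carrier \<Omega> K = Pt ` closure \<Omega> \<union> End ` ends \<Omega> K"

definition end_nhd ::
  "complex set \<Rightarrow> (nat \<Rightarrow> complex set) \<Rightarrow> (nat \<Rightarrow> complex set) \<Rightarrow> nat \<Rightarrow> end_point set" where
  "end_nhd \<Omega> K F j = Pt ` F j \<union> End ` {G \<in> ends \<Omega> K. \<forall>\<nu>\<le>j. G \<nu> = F \<nu>}"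

text \<open>The topology given by the neighbourhood bases: a set is open iff it contains a basic
  neighbourhood of each of its points. The sets \<open>end_nhd \<Omega> K F j\<close> are themselves open as soon as
  the components of \<open>closure \<Omega> - K j\<close> are relatively open (e.g. if \<open>closure \<Omega>\<close> is locally
  connected), which \<open>condition2\<close> implies.\<close>

definition end_open :: "complex set \<Rightarrow> (nat \<Rightarrow> complex set) \<Rightarrow> end_point set \<Rightarrow> bool" where
  "end_open \<Omega> K U \<longleftrightarrow> U \<subseteq> end_carrier \<Omega> K \<and>
     (\<forall>z. Pt z \<in> U \<longrightarrow> (\<exists>\<epsilon>>0. Pt ` (closure \<Omega> \<inter> ball z \<epsilon>) \<subseteq> U)) \<and>
     (\<forall>F. End F \<in> U \<longrightarrow> (\<exists>j. end_nhd \<Omega> K F j \<subseteq> U))"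

definition end_topology :: "complex set \<Rightarrow> (nat \<Rightarrow> complex set) \<Rightarrow> end_point topology" where
  "end_topology \<Omega> K = topology (end_open \<Omega> K)"

lemma end_nhd_antimono:
  assumes "F \<in> ends \<Omega> K" "i \<le> j"
  shows "end_nhd \<Omega> K F j \<subseteq> end_nhd \<Omega> K F i"
proof -
  have "F (Suc n) \<subseteq> F n" for n
    using assms(1) by (auto simp: ends_def split: if_splits)
  then have "F j \<subseteq> F i"
    using assms(2) by (rule lift_Suc_antimono_le)
  then show ?thesis
    using assms(2) by (auto simp: end_nhd_def)
qed

lemma istopology_end_open: "istopology (end_open \<Omega> K)"
proof -
  have pt: "\<exists>\<epsilon>>0. Pt ` (closure \<Omega> \<inter> ball z \<epsilon>) \<subseteq> U" if "end_open \<Omega> K U" "Pt z \<in> U" for U z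
    using that by (simp add: end_open_def)
  have nhd: "\<exists>j. end_nhd \<Omega> K F j \<subseteq> U" if "end_open \<Omega> K U" "End F \<in> U" for U F
    using that by (simp add: end_open_def)
  have sub: "U \<subseteq> end_carrier \<Omega> K" if "end_open \<Omega> K U" for U
    using that by (simp add: end_open_def)
  have "end_open \<Omega> K (U \<inter> V)" if U: "end_open \<Omega> K U" and V: "end_open \<Omega> K V" for U V
    unfolding end_open_def
  proof (intro conjI allI impI)
    show "U \<inter> V \<subseteq> end_carrier \<Omega> K"
      using sub[OF U] by (rule le_infI1)
  next
    fix z assume z: "Pt z \<in> U \<inter> V"
    obtain d where d: "d > 0" "Pt ` (closure \<Omega> \<inter> ball z d) \<subseteq> U"
      using pt[OF U IntD1[OF z]] by (elim exE conjE)
    obtain e where e: "e > 0" "Pt ` (closure \<Omega> \<inter> ball z e) \<subseteq> V"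
      using pt[OF V IntD2[OF z]] by (elim exE conjE)
    have "Pt ` (closure \<Omega> \<inter> ball z (min d e)) \<subseteq> U \<inter> V"
      using d(2) e(2) by (simp add: image_subset_iff)
    then show "\<exists>\<epsilon>>0. Pt ` (closure \<Omega> \<inter> ball z \<epsilon>) \<subseteq> U \<inter> V"
      using d(1) e(1) by (intro exI[of _ "min d e"]) simp
  next
    fix F assume F: "End F \<in> U \<inter> V"
    obtain i where i: "end_nhd \<Omega> K F i \<subseteq> U"
      using nhd[OF U IntD1[OF F]] by (elim exE)
    obtain j where j: "end_nhd \<Omega> K F j \<subseteq> V"
      using nhd[OF V IntD2[OF F]] by (elim exE)
    have "End F \<in> end_carrier \<Omega> K"
      using sub[OF U] F by (elim IntE subsetD)
    then have "F \<in> ends \<Omega> K"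
      by (auto simp: end_carrier_def)
    then have "end_nhd \<Omega> K F (max i j) \<subseteq> U \<inter> V"
      by (intro Int_greatest order_trans[OF end_nhd_antimono i] order_trans[OF end_nhd_antimono j])
        simp_all
    then show "\<exists>j. end_nhd \<Omega> K F j \<subseteq> U \<inter> V" ..
  qed
  moreover have "end_open \<Omega> K (\<Union>\<U>)" if *: "\<forall>U\<in>\<U>. end_open \<Omega> K U" for \<U>
    unfolding end_open_def
  proof (intro conjI allI impI)
    show "\<Union>\<U> \<subseteq> end_carrier \<Omega> K"
      using * sub by (simp add: Sup_le_iff)
  next
    fix z assume "Pt z \<in> \<Union>\<U>"
    then obtain U where U: "U \<in> \<U>" "Pt z \<in> U" by (elim UnionE)
    then obtain \<epsilon> where "\<epsilon> > 0" "Pt ` (closure \<Omega> \<inter> ball z \<epsilon>) \<subseteq> U"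
      using pt[OF bspec[OF * U(1)] U(2)] by (elim exE conjE)
    then show "\<exists>\<epsilon>>0. Pt ` (closure \<Omega> \<inter> ball z \<epsilon>) \<subseteq> \<Union>\<U>"
      using Union_upper[OF U(1)] by (intro exI[of _ \<epsilon>]) simp
  next
    fix F assume "End F \<in> \<Union>\<U>"
    then obtain U where U: "U \<in> \<U>" "End F \<in> U" by (elim UnionE)
    then obtain j where "end_nhd \<Omega> K F j \<subseteq> U"
      using nhd[OF bspec[OF * U(1)] U(2)] by (elim exE)
    then show "\<exists>j. end_nhd \<Omega> K F j \<subseteq> \<Union>\<U>"
      using Union_upper[OF U(1)] by (intro exI[of _ j]) simp
  qed
  ultimately show ?thesis
    by (simp add: istopology_def)
qed

lemma openin_end_topology: "openin (end_topology \<Omega> K) = end_open \<Omega> K"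
  unfolding end_topology_def by (simp add: istopology_end_open)

lemma topspace_end_topology: "topspace (end_topology \<Omega> K) = end_carrier \<Omega> K"
proof -
  have nhd: "end_nhd \<Omega> K F j \<subseteq> end_carrier \<Omega> K" if "F \<in> ends \<Omega> K" for F j
  proof -
    have "F j \<in> components (closure \<Omega> - K j)"
      using that by (auto simp: ends_def split: if_splits)
    then have "F j \<subseteq> closure \<Omega>"
      using in_components_subset by fastforce
    then show ?thesis
      by (auto simp: end_nhd_def end_carrier_def)
  qed
  have pt: "Pt ` (closure \<Omega> \<inter> ball z 1) \<subseteq> end_carrier \<Omega> K" for z
    by (auto simp: end_carrier_def)
  have "F \<in> ends \<Omega> K" if "End F \<in> end_carrier \<Omega> K" for F
    using that by (auto simp: end_carrier_def)
  then have "end_open \<Omega> K (end_carrier \<Omega> K)"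
    unfolding end_open_def
    by (intro conjI allI impI exI[of _ 1] exI[of _ 0] subset_refl nhd pt zero_less_one)
  then show ?thesis
    unfolding topspace_def openin_end_topology by (auto simp: end_open_def)
qed

definition end_boundary :: "complex set \<Rightarrow> (nat \<Rightarrow> complex set) \<Rightarrow> end_point set" where
  "end_boundary \<Omega> K = end_carrier \<Omega> K - Pt ` \<Omega>"


section \<open>Visibility\<close>

definition visible_pair ::
  "complex set \<Rightarrow> (nat \<Rightarrow> complex set) \<Rightarrow> real \<Rightarrow> real \<Rightarrow> end_point \<Rightarrow> end_point \<Rightarrow> bool" where
  "visible_pair \<Omega> K \<Lambda> \<kappa> \<zeta> \<eta> \<longleftrightarrow>
     (\<exists>V W C. V \<subseteq> end_carrier \<Omega> K \<and> W \<subseteq> end_carrier \<Omega> K \<and>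
        \<zeta> \<in> end_topology \<Omega> K interior_of V \<and> \<eta> \<in> end_topology \<Omega> K interior_of W \<and>
        end_topology \<Omega> K closure_of V \<inter> end_topology \<Omega> K closure_of W = {} \<and>
        compact C \<and> C \<subseteq> \<Omega> \<and>
        (\<forall>T\<ge>0. \<forall>\<sigma>. almost_geodesic \<Omega> \<Lambda> \<kappa> {0..T} \<sigma> \<and> Pt (\<sigma> 0) \<in> V \<and> Pt (\<sigma> T) \<in> W \<longrightarrow>
           \<sigma> ` {0..T} \<inter> C \<noteq> {}))"

text \<open>The end compactification does not depend on the exhaustion up to homeomorphism; visibility
  is required for every choice. In the bounded case the exhaustion plays no role, and exhaustions
  exist in all cases.\<close>

definition visibility_domain :: "complex set \<Rightarrow> bool" where
  "visibility_domain \<Omega> \<longleftrightarrow> hyperbolic_domain \<Omega> \<and>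
     (\<forall>K. compact_exhaustion (closure \<Omega>) K \<longrightarrow>
       (\<forall>\<Lambda>\<ge>1. \<forall>\<kappa>>0. \<forall>\<zeta> \<in> end_boundary \<Omega> K. \<forall>\<eta> \<in> end_boundary \<Omega> K.
          \<zeta> \<noteq> \<eta> \<longrightarrow> visible_pair \<Omega> K \<Lambda> \<kappa> \<zeta> \<eta>))"

lemma compact_exhaustion_cball:
  fixes X :: "complex set"
  assumes "closed X"
  shows "compact_exhaustion X (\<lambda>j. X \<inter> cball 0 (real j))"
  unfolding compact_exhaustion_def
proof (intro conjI allI)
  fix j
  show "compact (X \<inter> cball 0 (real j))"
    using assms by (simp add: closed_Int_compact)
  show "X \<inter> cball 0 (real j) \<subseteq> top_of_set X interior_of (X \<inter> cball 0 (real (Suc j)))"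
  proof (rule order_trans[OF _ interior_of_maximal])
    show "X \<inter> cball 0 (real j) \<subseteq> X \<inter> ball 0 (real (Suc j))"
      by auto
    show "X \<inter> ball 0 (real (Suc j)) \<subseteq> X \<inter> cball 0 (real (Suc j))"
      by auto
    show "openin (top_of_set X) (X \<inter> ball 0 (real (Suc j)))"
      by (simp add: openin_open_Int)
  qed
next
  show "(\<Union>j. X \<inter> cball 0 (real j)) = X"
    by (auto simp: real_arch_simple)
qed

end

(* The argument is by contradiction. If visibility fails, almost-geodesics sigma_n leave every
   compact subset of the domain and yet join two sets at positive distance, one of them relatively
   compact. As S is totally disconnected, a small neighbourhood of a limit point has frontier
   disjoint from S, and the curves cross this frontier near some boundary point p outside S.
   Condition 2 provides a map phi of the disc near p, and the lifts of the sigma_n by phi start near 1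
   and travel a fixed Euclidean distance within smaller and smaller neighbourhoods of the unit circle.
   By Schottky's theorem a disc in the domain centred near p stays near p on a quarter of its
   radius, hence factors through phi, so that Schwarz-Pick bounds the speed of the lift by a multiple
   of 1 - |w|. On the other hand the lower quasi-geodesic inequality passes to the hyperbolic distance of the disc, because phi is
   distance decreasing. Both together give exponential decay of the Euclidean speed from the
   point closest to the centre, so the Euclidean diameter of the lift tends to 0, a contradiction.

   To separate two ends one also needs the components of closure Omega - K_j to be relatively open;
   this local connectedness of closure Omega follows from Condition 2 by the same crossing argument. *)

theory Submission
  imports Defs
begin

section \<open>Absolutely continuous curves\<close>

text \<open>Domain and disc have to be compared in two directions of unequal difficulty. For
  distances the easy inequality suffices: a holomorphic map is distance decreasing, so long time
  intervals force long hyperbolic distances in the disc. Only the infinitesimal metric has to be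
  localised, and there a uniform multiplicative constant is enough, since the exponential decay
  absorbs it. The obstacle is the boundary behaviour of \<open>\<phi>\<close>. It is merely
  continuous on the circle, may identify boundary points, and its fibre over \<open>p\<close> may a
  priori accumulate at 1. Hence the search for one circle about 1 on which \<open>\<phi>\<close>
  avoids \<open>p\<close>. This circle serves twice: its image is a barrier at positive distance
  from \<open>p\<close>, so small connected sets cannot leave the chart, and its endpoint on the
  unit circle supplies the second omitted value that Schottky's theorem requires.\<close>

lemma measure_division_of:
  fixes d :: "'a::euclidean_space set set"
  assumes d: "d division_of \<Union>d"
  shows "measure lebesgue (\<Union>d) = (\<Sum>K\<in>d. measure lebesgue K)"
proof (rule measure_negligible_finite_Union)
  show "finite d" using d by (rule division_of_finite)
  show "K \<in> lmeasurable" if "K \<in> d" for K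
    using cbox_division_memE[OF that d] by (metis lmeasurable_cbox)
  show "pairwise (\<lambda>S T. negligible (S \<inter> T)) d"
  proof (rule pairwiseI)
    fix S T assume ST: "S \<in> d" "T \<in> d" "S \<noteq> T"
    have "convex S" "convex T"
      using cbox_division_memE[OF ST(1) d] cbox_division_memE[OF ST(2) d]
      by (metis convex_box(1))+
    then have "convex (S \<inter> T)" by (rule convex_Int)
    moreover have "interior (S \<inter> T) = {}"
      using division_ofD(5)[OF d ST] by simp
    ultimately show "negligible (S \<inter> T)"
      using negligible_convex_interior by blast
  qed
qed

text \<open>The straddle estimate: as \<open>t\<close> lies between \<open>u\<close> and
  \<open>v\<close>, the two one-sided errors add up to exactly \<open>e\<close> times the length
  \<open>v - u\<close>.\<close>

lemma norm_diff_le_of_linear_approx: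
  fixes f :: "real \<Rightarrow> complex"
  assumes "u \<le> t" "t \<le> v"
    and "norm (f u - f t - (u - t) *\<^sub>R w) \<le> e * \<bar>u - t\<bar>"
    and "norm (f v - f t - (v - t) *\<^sub>R w) \<le> e * \<bar>v - t\<bar>"
  shows "norm (f v - f u - (v - u) *\<^sub>R w) \<le> e * (v - u)"
proof -
  have "f v - f u - (v - u) *\<^sub>R w = (f v - f t - (v - t) *\<^sub>R w) - (f u - f t - (u - t) *\<^sub>R w)"
    by (simp add: algebra_simps scaleR_diff_left)
  then have "norm (f v - f u - (v - u) *\<^sub>R w) \<le> norm (f v - f t - (v - t) *\<^sub>R w) + norm (f u - f t - (u - t) *\<^sub>R w)"
    by (metis norm_triangle_ineq4)
  also have "\<dots> \<le> e * (v - t) + e * (t - u)"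
    using assms by (intro add_mono) auto
  finally show ?thesis by (simp add: algebra_simps)
qed

text \<open>A mean value inequality with an exceptional null set, proved with a gauge in the style
  of Henstock. Tags in \<open>N\<close> have their intervals inside an open set of measure below the
  \<open>\<delta>\<close> of absolute continuity; at all other tags \<open>f\<close> and
  \<open>h\<close> are simultaneously close to linear. Comparing with increments of \<open>h\<close>
  avoids integrating the speed.\<close>

lemma absolutely_continuous_norm_diff_le:
  fixes f :: "real \<Rightarrow> complex" and h h' :: "real \<Rightarrow> real"
  assumes ab: "a \<le> b" and ac: "absolutely_continuous_on {a..b} f"
    and N: "N \<in> null_sets lebesgue"
    and f': "\<And>t. t \<in> {a..b} - N \<Longrightarrow> \<exists>v. (f has_vector_derivative v) (at t within {a..b}) \<and> norm v \<le> h' t"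
    and h': "\<And>t. t \<in> {a..b} \<Longrightarrow> (h has_real_derivative h' t) (at t)"
    and nn: "\<And>t. t \<in> {a..b} \<Longrightarrow> 0 \<le> h' t"
  shows "norm (f b - f a) \<le> h b - h a"
proof (rule field_le_epsilon)
  fix e :: real assume e: "0 < e"
  \<comment> \<open>A good interval costs \<open>2 * e1\<close> times its length, one
    \<open>e1\<close> for \<open>f\<close> and one for \<open>h\<close>. The \<open>+ 1\<close>
    keeps the denominator positive when \<open>a = b\<close>.\<close>
  define e1 where "e1 = e / (2 * (2 * (b - a) + 1))"
  have e1: "0 < e1" "2 * e1 * (b - a) \<le> e / 2"
    using e ab unfolding e1_def by (auto simp: field_simps)
  have e2: "0 < e / 2" using e by simp
  obtain \<delta> where \<delta>: "\<delta> > 0" and ac\<delta>: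
    "\<And>d. d division_of \<Union>d \<Longrightarrow> \<Union>d \<subseteq> {a..b} \<Longrightarrow> (\<Sum>J\<in>d. Sup J - Inf J) < \<delta> \<Longrightarrow>
        (\<Sum>J\<in>d. cmod (f (Sup J) - f (Inf J))) < e / 2"
    using ac[unfolded absolutely_continuous_on_def, rule_format, OF e2] by auto
  obtain U where U: "open U" "N \<subseteq> U" and UN: "U - N \<in> lmeasurable" "emeasure lebesgue (U - N) < ennreal \<delta>"
    using sets_lebesgue_outer_open[OF null_setsD2[OF N] \<delta>] by metis
  have Um: "U \<in> lmeasurable" and UM: "measure lebesgue U < \<delta>"
  proof -
    have *: "U = (U - N) \<union> N" using U by auto
    have Ns: "N \<in> lmeasurable" "measure lebesgue N = 0"
      using N by (auto simp: null_sets_def fmeasurable_def measure_def)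
    show 1: "U \<in> lmeasurable" using * UN(1) Ns by (metis fmeasurable.Un)
    have "measure lebesgue U \<le> measure lebesgue (U - N) + measure lebesgue N"
      using * UN(1) Ns measure_Un_le[of "U - N" lebesgue N] by (metis fmeasurableD)
    moreover have "measure lebesgue (U - N) < \<delta>"
      using UN \<delta> by (simp add: emeasure_eq_measure2 ennreal_less_iff)
    ultimately show "measure lebesgue U < \<delta>" using Ns by simp
  qed
  have ex: "\<exists>r>0. (t \<in> N \<longrightarrow> ball t r \<subseteq> U) \<and>
      (t \<in> {a..b} - N \<longrightarrow> (\<exists>v. norm v \<le> h' t \<and>
        (\<forall>y\<in>{a..b}. \<bar>y - t\<bar> < r \<longrightarrow> norm (f y - f t - (y - t) *\<^sub>R v) \<le> e1 * \<bar>y - t\<bar> \<and>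
           \<bar>h y - h t - (y - t) * h' t\<bar> \<le> e1 * \<bar>y - t\<bar>)))" for t
  proof (cases "t \<in> N")
    case True
    then show ?thesis using U by (metis DiffD2 openE subset_iff)
  next
    case F: False
    show ?thesis
    proof (cases "t \<in> {a..b}")
      case T: True
      obtain v where v: "(f has_vector_derivative v) (at t within {a..b})" "norm v \<le> h' t"
        using f' T F by blast
      obtain r1 where r1: "r1 > 0" "\<And>y. y \<in> {a..b} \<Longrightarrow> norm (y - t) < r1 \<Longrightarrow> norm (f y - f t - (y - t) *\<^sub>R v) \<le> e1 * norm (y - t)"
        using v(1) e1(1) unfolding has_vector_derivative_def has_derivative_within_alt by meson
      obtain r2 where r2: "r2 > 0" "\<And>y. norm (y - t) < r2 \<Longrightarrow> norm (h y - h t - h' t * (y - t)) \<le> e1 * norm (y - t)"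
        using h'[OF T] e1(1) unfolding has_field_derivative_def has_derivative_within_alt by (meson UNIV_I)
      show ?thesis
        using r1 r2 v(2) F by (intro exI[of _ "min r1 r2"]) (auto intro!: exI[of _ v] simp: mult.commute)
    next
      case False
      then show ?thesis using F by (auto intro: exI[of _ 1])
    qed
  qed
  then obtain r where rpos: "\<And>t. r t > 0" and rN: "\<And>t. t \<in> N \<Longrightarrow> ball t (r t) \<subseteq> U"
    and rG: "\<And>t. t \<in> {a..b} - N \<Longrightarrow> (\<exists>v. norm v \<le> h' t \<and>
        (\<forall>y\<in>{a..b}. \<bar>y - t\<bar> < r t \<longrightarrow> norm (f y - f t - (y - t) *\<^sub>R v) \<le> e1 * \<bar>y - t\<bar> \<and>
           \<bar>h y - h t - (y - t) * h' t\<bar> \<le> e1 * \<bar>y - t\<bar>))"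
    by metis
  have "gauge (\<lambda>t. ball t (r t))" using rpos by (simp add: gauge_def)
  then obtain p where p: "p tagged_division_of {a..b}" and fine: "(\<lambda>t. ball t (r t)) fine p"
    using fine_division_exists_real by blast
  have hmono: "h u \<le> h v" if "a \<le> u" "u \<le> v" "v \<le> b" for u v
    proof (rule DERIV_nonneg_imp_nondecreasing[OF that(2)])
    show "\<exists>y. (h has_real_derivative y) (at x) \<and> 0 \<le> y" if "u \<le> x" "x \<le> v" for x
      using h'[of x] nn[of x] that \<open>a \<le> u\<close> \<open>v \<le> b\<close> by (intro exI[of _ "h' x"]) auto
  qed
  have pD: "\<exists>u v. K = {u..v} \<and> a \<le> u \<and> u \<le> x \<and> x \<le> v \<and> v \<le> b \<and> Sup K = v \<and> Inf K = u" if xKp: "(x, K) \<in> p" for x K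
  proof -
    obtain u v where "K = cbox u v" using tagged_division_ofD(4)[OF p xKp] by blast
    moreover have "x \<in> K" "K \<subseteq> {a..b}" using tagged_division_ofD(2,3)[OF p xKp] by auto
    ultimately show ?thesis by (intro exI[of _ u] exI[of _ v]) auto
  qed
  \<comment> \<open>The value 0 on the empty set, as on degenerate intervals, makes \<open>F\<close>
    vanish on every interval with empty interior. This allows the sum over tagged intervals to be
    replaced by the sum over the intervals alone.\<close>
  define F where "F = (\<lambda>K::real set. if K = {} then 0 else cmod (f (Sup K) - f (Inf K)))"
  have Feq: "F K = cmod (f (Sup K) - f (Inf K))" if "(x, K) \<in> p" for x K
    using tagged_division_ofD(2)[OF p that] by (auto simp: F_def)
  define H where "H = (\<lambda>K::real set. h (Sup K) - h (Inf K))"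
  define p1 where "p1 = {xk \<in> p. fst xk \<in> N}"
  define p2 where "p2 = {xk \<in> p. fst xk \<notin> N}"
  have pp: "p = p1 \<union> p2" "p1 \<inter> p2 = {}" by (auto simp: p1_def p2_def)
  have finp: "finite p" using p by blast
  have fin: "finite p1" "finite p2" using finp by (auto simp: p1_def p2_def)
  have H0: "H K \<ge> 0" if "(x, K) \<in> p" for x K
    using pD[OF that] hmono unfolding H_def by fastforce
  have good: "F K \<le> H K + 2 * e1 * (Sup K - Inf K)" if xK: "(x, K) \<in> p2" for x K
  proof -
    have xp: "(x, K) \<in> p" "x \<notin> N" using xK by (auto simp: p2_def)
    obtain u v where uv: "K = {u..v}" "a \<le> u" "u \<le> x" "x \<le> v" "v \<le> b" "Sup K = v" "Inf K = u"
      using pD[OF xp(1)] by blast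
    have sub: "{u..v} \<subseteq> ball x (r x)" using fineD[OF fine xp(1)] uv(1) by simp
    have "\<bar>u - x\<bar> < r x" "\<bar>v - x\<bar> < r x"
      using subsetD[OF sub, of u] subsetD[OF sub, of v] uv by (auto simp: dist_real_def)
    moreover obtain w where "norm w \<le> h' x"
        and *: "\<And>y. y\<in>{a..b} \<Longrightarrow> \<bar>y - x\<bar> < r x \<Longrightarrow> norm (f y - f x - (y - x) *\<^sub>R w) \<le> e1 * \<bar>y - x\<bar> \<and>
           \<bar>h y - h x - (y - x) * h' x\<bar> \<le> e1 * \<bar>y - x\<bar>"
      using rG[of x] xp uv by auto
    ultimately have A: "norm (f v - f u - (v - u) *\<^sub>R w) \<le> e1 * (v - u)"
      and B: "\<bar>h u - h x - (u - x) * h' x\<bar> \<le> e1 * \<bar>u - x\<bar>" "\<bar>h v - h x - (v - x) * h' x\<bar> \<le> e1 * \<bar>v - x\<bar>"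
      using uv *[of u] *[of v] by (auto intro!: norm_diff_le_of_linear_approx[of u x v])
    have "norm (f v - f u) \<le> norm ((v - u) *\<^sub>R w) + e1 * (v - u)"
      using A norm_triangle_sub[of "f v - f u" "(v - u) *\<^sub>R w"] by linarith
    also have "norm ((v - u) *\<^sub>R w) \<le> (v - u) * h' x"
      using uv \<open>norm w \<le> h' x\<close> by (auto intro!: mult_mono)
    also have "(v - u) * h' x \<le> h v - h u + e1 * (v - u)"
    proof -
      have "e1 * \<bar>u - x\<bar> = e1 * (x - u)" "e1 * \<bar>v - x\<bar> = e1 * (v - x)" using uv by auto
      then show ?thesis using B by (simp add: algebra_simps abs_le_iff)
    qed
    finally show ?thesis using uv unfolding Feq[OF xp(1)] H_def by (simp add: algebra_simps)
  qed
  have bad: "(\<Sum>(x,K)\<in>p1. F K) < e / 2"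
  proof -
    have tp: "p1 tagged_partial_division_of {a..b}"
      using p tagged_partial_division_subset[of p "{a..b}" p1] pp(1)
      unfolding tagged_division_of_def by blast
    let ?d = "snd ` p1"
    have dd: "?d division_of \<Union>?d" using partial_division_of_tagged_division[OF tp] .
    have sub: "\<Union>?d \<subseteq> {a..b}" using tagged_partial_division_ofD(3)[OF tp] by fastforce
    have subU: "\<Union>?d \<subseteq> U"
      using fine rN unfolding fine_def p1_def by fastforce
    have "(\<Sum>J\<in>?d. Sup J - Inf J) = (\<Sum>J\<in>?d. measure lebesgue J)"
    proof (rule sum.cong)
      fix J assume "J \<in> ?d"
      then obtain x where "(x, J) \<in> p" by (auto simp: p1_def)
      then obtain u v where "J = {u..v}" "u \<le> v" "Sup J = v" "Inf J = u" using pD[of x J] by fastforce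
      then show "Sup J - Inf J = measure lebesgue J" by simp
    qed simp
    also have "\<dots> = measure lebesgue (\<Union>?d)" using measure_division_of[OF dd] by simp
    also have "\<dots> \<le> measure lebesgue U"
      using subU Um division_of_closed[OF dd] by (intro measure_mono_fmeasurable) auto
    also have "\<dots> < \<delta>" by (rule UM)
    finally have "(\<Sum>J\<in>?d. cmod (f (Sup J) - f (Inf J))) < e / 2" using ac\<delta>[OF dd sub] by blast
    moreover have "(\<Sum>J\<in>?d. F J) = (\<Sum>J\<in>?d. cmod (f (Sup J) - f (Inf J)))"
      using Feq by (intro sum.cong) (auto simp: p1_def)
    moreover have "(\<Sum>(x,K)\<in>p1. F K) = (\<Sum>J\<in>?d. F J)"
    proof (rule sum.over_tagged_division_lemma[OF tagged_partial_division_of_Union_self[OF tp]])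
      fix u v :: real assume "box u v = {}"
      then have "cbox u v = {} \<or> u = v" by (auto simp: box_real cbox_interval)
      then show "F (cbox u v) = 0" by (auto simp: F_def)
    qed
    ultimately show ?thesis by simp
  qed
  have "norm (f b - f a) = norm (\<Sum>(x,K)\<in>p. f (Sup K) - f (Inf K))"
    using additive_tagged_division_1[OF ab p, of f] by simp
  also have "\<dots> \<le> (\<Sum>(x,K)\<in>p. F K)"
    using Feq by (intro order_trans[OF norm_sum] sum_mono) auto
  also have "\<dots> = (\<Sum>(x,K)\<in>p1. F K) + (\<Sum>(x,K)\<in>p2. F K)"
    using pp fin by (metis sum.union_disjoint)
  also have "(\<Sum>(x,K)\<in>p2. F K) \<le> (\<Sum>(x,K)\<in>p2. H K + 2 * e1 * (Sup K - Inf K))"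
    using good by (intro sum_mono) auto
  \<comment> \<open>Putting the bad intervals back only increases the sum, as \<open>h\<close> is
    nondecreasing; over the whole partition it telescopes.\<close>
  also have "\<dots> \<le> (\<Sum>(x,K)\<in>p. H K + 2 * e1 * (Sup K - Inf K))"
  proof (rule sum_mono2[OF finp])
    show "p2 \<subseteq> p" using pp by blast
    show "0 \<le> (case xk of (x, K) \<Rightarrow> H K + 2 * e1 * (Sup K - Inf K))" if "xk \<in> p - p2" for xk
    proof -
      obtain x K where xk: "xk = (x, K)" "(x, K) \<in> p" using \<open>xk \<in> p - p2\<close> by (cases xk) auto
      then show ?thesis using pD[OF xk(2)] H0[OF xk(2)] e1 by fastforce
    qed
  qed
  also have "\<dots> = (\<Sum>(x,K)\<in>p. h (Sup K) - h (Inf K)) + 2 * e1 * (\<Sum>(x,K)\<in>p. Sup K - Inf K)"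
    by (simp add: case_prod_unfold H_def sum.distrib sum_distrib_left)
  also have "\<dots> = h b - h a + 2 * e1 * (b - a)"
    using additive_tagged_division_1[OF ab p, of h] additive_tagged_division_1[OF ab p, of "\<lambda>x. x"] by simp
  finally show "norm (f b - f a) \<le> h b - h a + e" using bad e1 by linarith
qed

lemma absolutely_continuous_on_subset:
  assumes "absolutely_continuous_on I f" "J \<subseteq> I"
  shows "absolutely_continuous_on J f"
  using assms unfolding absolutely_continuous_on_def by (meson order_trans)

lemma absolutely_continuous_on_compose_lipschitz:
  fixes f :: "real \<Rightarrow> complex" and g :: "complex \<Rightarrow> complex"
  assumes ac: "absolutely_continuous_on {a..b} f" and lip: "L-lipschitz_on (f ` {a..b}) g"
  shows "absolutely_continuous_on {a..b} (\<lambda>t. g (f t))"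
  unfolding absolutely_continuous_on_def
proof (intro allI impI)
  fix e :: real assume e: "0 < e"
  have L: "L \<ge> 0" using lip by (rule lipschitz_on_nonneg)
  \<comment> \<open>\<open>L + 1\<close> in place of \<open>L\<close> admits \<open>L = 0\<close>
    and makes the final inequality strict.\<close>
  have eL: "e / (L + 1) > 0" using e L by simp
  then obtain \<delta> where \<delta>: "\<delta> > 0" and *:
    "\<And>d. d division_of \<Union>d \<Longrightarrow> \<Union>d \<subseteq> {a..b} \<Longrightarrow> (\<Sum>J\<in>d. Sup J - Inf J) < \<delta> \<Longrightarrow>
        (\<Sum>J\<in>d. cmod (f (Sup J) - f (Inf J))) < e / (L + 1)"
    using ac[unfolded absolutely_continuous_on_def, rule_format, OF eL] by auto
  have "(\<Sum>J\<in>d. cmod (g (f (Sup J)) - g (f (Inf J)))) < e"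
    if d: "d division_of \<Union>d" "\<Union>d \<subseteq> {a..b}" "(\<Sum>J\<in>d. Sup J - Inf J) < \<delta>" for d
  proof -
    have "(\<Sum>J\<in>d. cmod (g (f (Sup J)) - g (f (Inf J)))) \<le> (\<Sum>J\<in>d. L * cmod (f (Sup J) - f (Inf J)))"
    proof (rule sum_mono)
      fix J assume J: "J \<in> d"
      obtain u v where uv: "J = {u..v}" "u \<le> v"
        using division_ofD(3,4)[OF d(1) J] by (metis atLeastatMost_empty_iff2 cbox_interval)
      have "{u..v} \<subseteq> {a..b}" using uv J d(2) by blast
      then have "Sup J \<in> {a..b}" "Inf J \<in> {a..b}" using uv by auto
      then show "cmod (g (f (Sup J)) - g (f (Inf J))) \<le> L * cmod (f (Sup J) - f (Inf J))"
        using lipschitz_onD[OF lip, of "f (Sup J)" "f (Inf J)"] by (simp add: dist_norm)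
    qed
    also have "\<dots> = L * (\<Sum>J\<in>d. cmod (f (Sup J) - f (Inf J)))" by (simp add: sum_distrib_left)
    also have "\<dots> \<le> L * (e / (L + 1))" using *[OF d] L by (intro mult_left_mono) auto
    also have "\<dots> < e" using L e by (simp add: field_simps)
    finally show ?thesis .
  qed
  then show "\<exists>\<delta>>0. \<forall>d. d division_of \<Union>d \<and> \<Union>d \<subseteq> {a..b} \<and> (\<Sum>J\<in>d. Sup J - Inf J) < \<delta> \<longrightarrow>
        (\<Sum>J\<in>d. cmod (g (f (Sup J)) - g (f (Inf J)))) < e"
    using \<delta> by blast
qed

lemma absolutely_continuous_on_imp_continuous_on:
  assumes ac: "absolutely_continuous_on I f" and I: "is_interval I"
  shows "continuous_on I f"
  unfolding continuous_on_iff
proof (intro ballI allI impI)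
  fix x and e :: real assume x: "x \<in> I" and e: "0 < e"
  obtain \<delta> where \<delta>: "\<delta> > 0" and *:
    "\<And>d. d division_of \<Union>d \<Longrightarrow> \<Union>d \<subseteq> I \<Longrightarrow> (\<Sum>J\<in>d. Sup J - Inf J) < \<delta> \<Longrightarrow>
        (\<Sum>J\<in>d. cmod (f (Sup J) - f (Inf J))) < e"
    using ac[unfolded absolutely_continuous_on_def, rule_format, OF e] by auto
  have **: "cmod (f v - f u) < e" if "u \<in> I" "v \<in> I" "u \<le> v" "v - u < \<delta>" for u v
  proof -
    have "{u..v} \<subseteq> I" using mem_is_interval_1_I[OF I that(1,2)] by auto
    moreover have "{{u..v}} division_of \<Union>{{u..v}}"
      using that division_of_self[of u v] by (simp add: cbox_interval)
    ultimately show ?thesis using *[of "{{u..v}}"] that by simp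
  qed
  have "dist (f y) (f x) < e" if "y \<in> I" "dist y x < \<delta>" for y
    proof (cases "x \<le> y")
    case True
    then show ?thesis using **[of x y] that x by (simp add: dist_norm)
  next
    case False
    then show ?thesis using **[of y x] that x by (simp add: dist_norm norm_minus_commute)
  qed
  then show "\<exists>d>0. \<forall>x'\<in>I. dist x' x < d \<longrightarrow> dist (f x') (f x) < e" using \<delta> by blast
qed

section \<open>Curves and holomorphic maps in the disc\<close>

lemma one_minus_cmod_Moebius_sq:
  assumes "cmod a < 1" "cmod b < 1"
  shows "1 - (cmod (Moebius_function 0 b a))\<^sup>2 =
    (1 - (cmod a)\<^sup>2) * (1 - (cmod b)\<^sup>2) / (cmod (1 - cnj b * a))\<^sup>2"
proof -
  have "cmod (cnj b * a) < 1 * 1"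
    unfolding norm_mult complex_mod_cnj using assms by (intro mult_strict_mono') auto
  then have "1 - cnj b * a \<noteq> 0" by auto
  moreover have "(cmod (1 - cnj b * a))\<^sup>2 - (cmod (a - b))\<^sup>2 = (1 - (cmod a)\<^sup>2) * (1 - (cmod b)\<^sup>2)"
    unfolding cmod_power2 by (simp add: algebra_simps power2_eq_square)
  ultimately show ?thesis
    by (simp add: Moebius_function_simple norm_divide power_divide field_simps)
qed

lemma poincare_dist_nonneg:
  assumes "a \<in> ball 0 1" "b \<in> ball 0 1"
  shows "0 \<le> poincare_dist a b"
proof -
  define m where "m = cmod (Moebius_function 0 b a)"
  have m: "0 \<le> m" "m < 1" using Moebius_function_norm_lt_1[of b a 0] assms by (auto simp: m_def)
  then have "(1 + m) / (1 - m) \<ge> 1" by (simp add: field_simps)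
  then show ?thesis using m by (simp add: poincare_dist_def artanh_def m_def)
qed

text \<open>With \<open>m\<close> the modulus of the Moebius quotient,
  \<open>(1 + m) / (1 - m)\<close> is \<open>(1 + m)^2 / (1 - m^2)\<close>. The numerator is at most
  4, and the denominator is at least a quarter of \<open>(1 - cmod a) * (1 - cmod b)\<close> because
  \<open>cmod (1 - cnj b * a) \<le> 2\<close>; hence the constant 16.\<close>

lemma poincare_dist_le:
  assumes "a \<in> ball 0 1" "b \<in> ball 0 1"
  shows "poincare_dist a b \<le> ln (16 / ((1 - cmod a) * (1 - cmod b))) / 2"
proof -
  define m where "m = cmod (Moebius_function 0 b a)"
  have ab: "cmod a < 1" "cmod b < 1" using assms by auto
  have m: "0 \<le> m" "m < 1" using Moebius_function_norm_lt_1[of b a 0] ab by (auto simp: m_def)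
  have "cmod (cnj b * a) < 1 * 1"
    unfolding norm_mult complex_mod_cnj using ab by (intro mult_strict_mono') auto
  then have c: "0 < cmod (1 - cnj b * a)" "cmod (1 - cnj b * a) \<le> 2"
    using norm_triangle_ineq4[of 1 "cnj b * a"] by auto
  then have "(cmod (1 - cnj b * a))\<^sup>2 \<le> 2\<^sup>2" by (intro power_mono) auto
  then have c4: "(cmod (1 - cnj b * a))\<^sup>2 \<le> 4" by simp
  have sq: "1 - x \<le> 1 - x\<^sup>2" if "0 \<le> x" "x < 1" for x :: real
    using that by (simp add: power2_eq_square mult_left_le)
  let ?P = "(1 - cmod a) * (1 - cmod b)"
  have P: "?P > 0" using ab by simp
  have "?P / 4 \<le> (1 - (cmod a)\<^sup>2) * (1 - (cmod b)\<^sup>2) / (cmod (1 - cnj b * a))\<^sup>2"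
    using ab c c4 sq[of "cmod a"] sq[of "cmod b"]
    by (intro frac_le mult_mono) (auto simp: power2_less_1_iff abs_square_less_1 intro: less_imp_le)
  then have m2: "?P / 4 \<le> (1 - m) * (1 + m)"
    unfolding one_minus_cmod_Moebius_sq[OF ab, symmetric] m_def[symmetric]
    by (simp add: power2_eq_square algebra_simps)
  have "(1 + m) * ?P \<le> (1 + m) * (4 * ((1 - m) * (1 + m)))"
    using m2 m by (intro mult_left_mono) auto
  also have "\<dots> = (1 - m) * (4 * ((1 + m) * (1 + m)))" by simp
  also have "\<dots> \<le> (1 - m) * (4 * (2 * 2))"
    using m by (intro mult_left_mono mult_mono) auto
  finally have "(1 + m) / (1 - m) \<le> 16 / ?P"
    using m P by (simp add: field_simps)
  then have "ln ((1 + m) / (1 - m)) \<le> ln (16 / ?P)"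
    using m P by (subst ln_le_cancel_iff) auto
  then show ?thesis by (simp add: poincare_dist_def artanh_def m_def)
qed

text \<open>The point of the curve farthest from the circle is used as origin of time: hyperbolic
  distances grow at least linearly from there, so that the Euclidean speed decays exponentially.\<close>

lemma disc_quasi_geodesic_diameter:
  fixes \<gamma> :: "real \<Rightarrow> complex"
  assumes ab: "a \<le> b" and ac: "absolutely_continuous_on {a..b} \<gamma>"
    and disc: "\<gamma> ` {a..b} \<subseteq> ball 0 1"
    and N: "N \<in> null_sets lebesgue"
    and speed: "\<And>t. t \<in> {a..b} - N \<Longrightarrow>
      \<exists>v. (\<gamma> has_vector_derivative v) (at t within {a..b}) \<and> norm v \<le> M * (1 - cmod (\<gamma> t))"
    and qg: "\<And>s t. s \<in> {a..b} \<Longrightarrow> t \<in> {a..b} \<Longrightarrow> \<bar>s - t\<bar> \<le> L * (poincare_dist (\<gamma> s) (\<gamma> t) + k)"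
    and M: "0 < M" and L: "0 < L"
    and close: "\<And>t. t \<in> {a..b} \<Longrightarrow> 1 - cmod (\<gamma> t) \<le> \<delta>"
  shows "cmod (\<gamma> b - \<gamma> a) \<le> 4 * L * M * sqrt (4 * exp k * \<delta>)"
proof -
  define h where "h t = 1 - cmod (\<gamma> t)" for t
  have cont: "continuous_on {a..b} \<gamma>"
    using ac is_interval_cc by (rule absolutely_continuous_on_imp_continuous_on)
  have hpos: "h t > 0" if "t \<in> {a..b}" for t using subsetD[OF disc imageI[OF that]] by (simp add: h_def)
  have "continuous_on {a..b} h" unfolding h_def using cont by (intro continuous_intros)
  moreover have "{a..b} \<noteq> {}" using ab by simp
  ultimately obtain t0 where t0: "t0 \<in> {a..b}" and hmax: "\<And>t. t \<in> {a..b} \<Longrightarrow> h t \<le> h t0"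
    using continuous_attains_sup[of "{a..b}" h] by auto
  define B where "B = sqrt (4 * exp k * \<delta>)"
  have decay: "h t \<le> B * exp (- \<bar>t - t0\<bar> / (2 * L))" if t: "t \<in> {a..b}" for t
  proof -
    have P: "0 < h t * h t0" using hpos t t0 by simp
    have "\<bar>t - t0\<bar> \<le> L * (ln (16 / (h t * h t0)) / 2 + k)"
      using subsetD[OF disc imageI[OF t]] subsetD[OF disc imageI[OF t0]] L unfolding h_def
      by (intro order_trans[OF qg[OF t t0]] mult_left_mono add_right_mono poincare_dist_le) auto
    then have "2 * \<bar>t - t0\<bar> / L - 2 * k \<le> ln (16 / (h t * h t0))"
      using L by (simp add: field_simps)
    then have "exp (2 * \<bar>t - t0\<bar> / L - 2 * k) \<le> 16 / (h t * h t0)"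
      using P by (subst (asm) ln_ge_iff) auto
    then have "h t * h t0 \<le> 16 / exp (2 * \<bar>t - t0\<bar> / L - 2 * k)"
      using P by (simp add: field_simps)
    also have "\<dots> = (4 * exp (k - \<bar>t - t0\<bar> / L))\<^sup>2"
      by (simp add: power_mult_distrib exp_double[symmetric] exp_minus[symmetric] field_simps exp_diff flip: exp_add)
    \<comment> \<open>Maximality of \<open>h t0\<close> turns the bound on the product over two
      points into a bound at the single point \<open>t\<close>.\<close>
    finally have "h t * h t \<le> (4 * exp (k - \<bar>t - t0\<bar> / L))\<^sup>2"
      using hmax[OF t] hpos[OF t] by (meson mult_left_mono less_imp_le order_trans)
    then have "h t \<le> 4 * exp (k - \<bar>t - t0\<bar> / L)"
      by (intro power2_le_imp_le[OF _ mult_nonneg_nonneg]) (simp_all only: power2_eq_square exp_ge_zero zero_le_numeral)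
    \<comment> \<open>One factor is bounded by \<open>\<delta>\<close>, the other by the
      exponential. Their geometric mean still decays, at half the rate, and gains a prefactor that
      is small with \<open>\<delta>\<close>.\<close>
    then have "h t * h t \<le> \<delta> * (4 * exp (k - \<bar>t - t0\<bar> / L))"
      using close[OF t] hpos[OF t] by (intro mult_mono) (auto simp: h_def)
    also have "\<dots> = (4 * exp k * \<delta>) * (exp (- \<bar>t - t0\<bar> / (2 * L)))\<^sup>2"
    proof -
      have "2 * (- \<bar>t - t0\<bar> / (2 * L)) = - \<bar>t - t0\<bar> / L" using L by simp
      then have "(exp (- \<bar>t - t0\<bar> / (2 * L)))\<^sup>2 = exp (- \<bar>t - t0\<bar> / L)" by (metis exp_double)
      moreover have "exp (k - \<bar>t - t0\<bar> / L) = exp k * exp (- \<bar>t - t0\<bar> / L)" by (simp flip: exp_add)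
      ultimately show ?thesis by simp
    qed
    finally have "h t \<le> sqrt ((4 * exp k * \<delta>) * (exp (- \<bar>t - t0\<bar> / (2 * L)))\<^sup>2)"
      by (intro real_le_rsqrt) (simp add: power2_eq_square)
    then show ?thesis by (simp add: B_def real_sqrt_mult)
  qed
  have "\<delta> \<ge> 0" using close[OF t0] hpos[OF t0] by (simp add: h_def)
  then have B: "B \<ge> 0" by (simp add: B_def)
  have speed': "\<exists>v. (\<gamma> has_vector_derivative v) (at t within J) \<and> norm v \<le> M * B * exp (- \<bar>t - t0\<bar> / (2 * L))"
    if t: "t \<in> J - N" and J: "J \<subseteq> {a..b}" for t J
  proof -
    have tN: "t \<in> {a..b} - N" using t J by blast
    obtain v where v: "(\<gamma> has_vector_derivative v) (at t within {a..b})" "norm v \<le> M * h t"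
      using speed[OF tN] by (auto simp: h_def)
    have "M * h t \<le> M * (B * exp (- \<bar>t - t0\<bar> / (2 * L)))"
      using decay[of t] tN M by (intro mult_left_mono) auto
    then show ?thesis
      using v has_vector_derivative_within_subset[OF v(1) J] by (intro exI[of _ v]) auto
  qed
  have right: "cmod (\<gamma> b - \<gamma> t0) \<le> 2 * L * M * B"
  proof -
    \<comment> \<open>The comparison function is a primitive of the speed bound and grows by at most
      \<open>2 * L * M * B\<close>; the two sides of \<open>t0\<close> together give the factor
      4.\<close>
    have "cmod (\<gamma> b - \<gamma> t0) \<le> (- (2 * L * M * B) * exp (- (b - t0) / (2 * L))) - (- (2 * L * M * B) * exp (- (t0 - t0) / (2 * L)))"
    proof (rule absolutely_continuous_norm_diff_le[OF _ _ N])
      show "t0 \<le> b" using t0 by simp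
      show "absolutely_continuous_on {t0..b} \<gamma>"
        using t0 by (intro absolutely_continuous_on_subset[OF ac]) auto
      show "\<exists>v. (\<gamma> has_vector_derivative v) (at t within {t0..b}) \<and> norm v \<le> M * B * exp (- (t - t0) / (2 * L))"
        if "t \<in> {t0..b} - N" for t
        using speed'[of t "{t0..b}"] that t0 by auto
      show "((\<lambda>t. - (2 * L * M * B) * exp (- (t - t0) / (2 * L))) has_real_derivative M * B * exp (- (t - t0) / (2 * L))) (at t)" for t
        using L by (auto intro!: derivative_eq_intros simp: field_simps)
      show "0 \<le> M * B * exp (- (t - t0) / (2 * L))" for t using M B by simp
    qed
    also have "\<dots> \<le> 2 * L * M * B" using L M B by simp
    finally show ?thesis .
  qed
  have left: "cmod (\<gamma> t0 - \<gamma> a) \<le> 2 * L * M * B"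
  proof -
    have "cmod (\<gamma> t0 - \<gamma> a) \<le> (2 * L * M * B) * exp ((t0 - t0) / (2 * L)) - (2 * L * M * B) * exp ((a - t0) / (2 * L))"
    proof (rule absolutely_continuous_norm_diff_le[OF _ _ N])
      show "a \<le> t0" using t0 by simp
      show "absolutely_continuous_on {a..t0} \<gamma>"
        using t0 by (intro absolutely_continuous_on_subset[OF ac]) auto
      show "\<exists>v. (\<gamma> has_vector_derivative v) (at t within {a..t0}) \<and> norm v \<le> M * B * exp ((t - t0) / (2 * L))"
        if "t \<in> {a..t0} - N" for t
        using speed'[of t "{a..t0}"] that t0 by auto
      show "((\<lambda>t. (2 * L * M * B) * exp ((t - t0) / (2 * L))) has_real_derivative M * B * exp ((t - t0) / (2 * L))) (at t)" for t
        using L by (auto intro!: derivative_eq_intros simp: field_simps)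
      show "0 \<le> M * B * exp ((t - t0) / (2 * L))" for t using M B by simp
    qed
    also have "\<dots> \<le> 2 * L * M * B" using L M B by simp
    finally show ?thesis .
  qed
  have "cmod (\<gamma> b - \<gamma> a) \<le> cmod (\<gamma> b - \<gamma> t0) + cmod (\<gamma> t0 - \<gamma> a)"
    using norm_triangle_ineq[of "\<gamma> b - \<gamma> t0" "\<gamma> t0 - \<gamma> a"] by simp
  then show ?thesis using right left by (simp add: B_def)
qed

text \<open>Schottky's theorem for the reciprocal, recentred at the point where smallness would fail.\<close>

lemma omitting_two_values_close:
  fixes p q :: complex
  assumes "p \<noteq> q" "0 < m"
  obtains \<eta> where "0 < \<eta>"
    "\<And>f z. f holomorphic_on ball 0 1 \<Longrightarrow> p \<notin> f ` ball 0 1 \<Longrightarrow> q \<notin> f ` ball 0 1 \<Longrightarrow>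
       cmod (f 0 - p) < \<eta> \<Longrightarrow> cmod z \<le> 1 / 4 \<Longrightarrow> cmod (f z - p) < m"
proof -
  define R where "R = cmod (q - p) / m"
  \<comment> \<open>The Schottky bound at radius 1/2 for functions of modulus at most
    \<open>R\<close> at 0; in the coordinate centred at \<open>z\<close> the old centre is the point
    \<open>- 2 * z\<close>.\<close>
  define B where "B = exp (pi * exp (pi * (2 + 2 * R + 12 * (1/2) / (1 - 1/2))))"
  have B: "B > 0" by (simp add: B_def)
  have \<eta>: "cmod (q - p) / B > 0" using B assms(1) by simp
  have "cmod (f z - p) < m"
    if f: "f holomorphic_on ball 0 1" "p \<notin> f ` ball 0 1" "q \<notin> f ` ball 0 1"
      and f0: "cmod (f 0 - p) < cmod (q - p) / B" and z: "cmod z \<le> 1 / 4" for f z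
  proof (rule ccontr)
    assume "\<not> cmod (f z - p) < m"
    then have fz: "m \<le> cmod (f z - p)" by simp
    define h where "h w = (q - p) / (f w - p)" for w
    \<comment> \<open>As \<open>cmod z \<le> 1 / 4\<close>, the closed disc of radius 1/2 about
      \<open>z\<close> stays inside the open unit disc. The function omits 0 because
      \<open>p \<noteq> q\<close>, and 1 because \<open>f\<close> omits \<open>q\<close>.\<close>
    define g where "g w = h (z + w / 2)" for w
    have in_ball: "z + w / 2 \<in> ball 0 1" if "w \<in> cball 0 1" for w
      using that z norm_triangle_ineq[of z "w / 2"] by (auto simp: norm_divide)
    have h: "h holomorphic_on ball 0 1"
      unfolding h_def using f by (intro holomorphic_intros) auto
    have "g holomorphic_on cball 0 1"
      unfolding g_def using in_ball
      by (intro holomorphic_on_compose_gen[OF _ h, unfolded o_def] holomorphic_intros) auto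
    moreover have "cmod (g 0) \<le> R"
      using fz assms(2) by (auto simp: g_def h_def R_def norm_divide intro!: divide_left_mono mult_pos_pos)
    moreover have "\<not> (g w = 0 \<or> g w = 1)" if "w \<in> cball 0 1" for w
    proof -
      have "f (z + w / 2) \<noteq> p" "f (z + w / 2) \<noteq> q" using in_ball[OF that] f(2,3) by blast+
      then show ?thesis using assms(1) by (auto simp: g_def h_def field_simps)
    qed
    ultimately have "cmod (g (- 2 * z)) \<le> B"
      unfolding B_def using z by (intro Schottky) (auto simp: norm_mult)
    then have "cmod (q - p) / cmod (f 0 - p) \<le> B" by (simp add: g_def h_def norm_divide)
    moreover have "f 0 \<noteq> p" using f(2) by force
    ultimately show False using f0 B by (simp add: field_simps)
  qed
  then show ?thesis using that[OF \<eta>] by blast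
qed

section \<open>Boundary arcs near 1 and the fibre over a boundary value\<close>

lemma arc_region_subset_ball:
  assumes "x1 \<in> sphere 0 1" "x2 \<in> sphere 0 1"
  shows "arc_region x1 x2 \<subseteq> ball 0 1"
proof
  fix z assume z: "z \<in> arc_region x1 x2"
  let ?A = "closed_arc x1 x2 \<union> closed_geodesic x1 x2"
  have arc: "open_arc x1 x2 \<subseteq> sphere 0 1"
    unfolding open_arc_def by (metis connected_component_subset Diff_subset subset_trans)
  have A: "?A \<subseteq> cball 0 1"
  proof -
    have "range \<gamma> \<subseteq> cball 0 1" if "poincare_geodesic_line x1 x2 \<gamma>" for \<gamma>
      using that ball_subset_cball unfolding poincare_geodesic_line_def by blast
    then show ?thesis
      using arc assms unfolding closed_arc_def closed_geodesic_def by fastforce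
  qed
  have nz: "z \<notin> ?A" and bdd: "bounded (connected_component_set (- ?A) z)"
    using z by (auto simp: arc_region_def inside_def)
  show "z \<in> ball 0 1"
  proof (rule ccontr)
    assume "z \<notin> ball 0 1"
    then have z1: "cmod z \<ge> 1" by simp
    \<comment> \<open>The radial ray from a point on or outside the unit circle leaves the closed
      disc at once, so it joins \<open>z\<close> to infinity in the complement of the curve.\<close>
    let ?R = "(\<lambda>t. of_real t * z) ` {1..}"
    have "connected ?R" by (intro connected_continuous_image continuous_intros) auto
    moreover have "z \<in> ?R" by (rule image_eqI[of _ _ 1]) auto
    moreover have "?R \<subseteq> - ?A"
    proof
      fix w assume "w \<in> ?R"
      then obtain t where t: "t \<ge> 1" "w = of_real t * z" by auto
      show "w \<in> - ?A"
      proof (cases "t = 1")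
        case True
        then show ?thesis using nz t by simp
      next
        case False
        then have "1 < t" using t by simp
        moreover have "t * 1 \<le> t * cmod z" using t z1 by (intro mult_left_mono) auto
        ultimately have "1 < t * cmod z" by linarith
        then have "w \<notin> cball 0 1" using t by (simp add: norm_mult)
        then show ?thesis using A by blast
      qed
    qed
    ultimately have "?R \<subseteq> connected_component_set (- ?A) z" by (intro connected_component_maximal)
    then have "bounded ?R" using bdd bounded_subset by blast
    then obtain B where B: "\<And>t. t \<ge> 1 \<Longrightarrow> cmod (of_real t * z) \<le> B"
      unfolding bounded_iff by auto
    have "(\<bar>B\<bar> + 2) * 1 \<le> (\<bar>B\<bar> + 2) * cmod z" using z1 by (intro mult_left_mono) auto
    also have "\<dots> = cmod (of_real (\<bar>B\<bar> + 2) * z)" by (simp add: norm_mult del: of_real_add)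
    also have "\<dots> \<le> B" by (rule B) simp
    finally show False by simp
  qed
qed

lemma open_arc_contains_nhd:
  assumes "x1 \<noteq> 1" "x2 \<noteq> 1"
  obtains r where "0 < r" "sphere 0 1 \<inter> ball 1 r \<subseteq> open_arc x1 x2"
proof -
  let ?U = "sphere 0 1 - {x1, x2}"
  have oU: "openin (top_of_set (sphere 0 1)) ?U"
    by (metis Diff_Diff_Int Diff_eq Int_commute finite.emptyI finite.insertI finite_imp_closed openin_open open_Compl)
  have "locally connected ?U" using locally_open_subset[OF locally_connected_sphere oU] .
  then have "openin (top_of_set ?U) (open_arc x1 x2)"
    unfolding open_arc_def by (rule openin_connected_component_locally_connected)
  then have "openin (top_of_set (sphere 0 1)) (open_arc x1 x2)" using oU openin_trans by blast
  moreover have "1 \<in> open_arc x1 x2"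
    unfolding open_arc_def using assms by (simp add: connected_component_refl)
  ultimately obtain r where "r > 0" "ball 1 r \<inter> sphere 0 1 \<subseteq> open_arc x1 x2"
    unfolding openin_contains_ball by blast
  then show ?thesis using that by (simp add: Int_commute)
qed

lemma dist_one_unit_circle:
  assumes "cmod z = 1"
  shows "(cmod (z - 1))\<^sup>2 = 2 - 2 * Re z"
proof -
  have "(Re z)\<^sup>2 + (Im z)\<^sup>2 = 1" using cmod_power2[of z] assms by simp
  then show ?thesis unfolding cmod_power2 by (simp add: power2_eq_square algebra_simps)
qed

text \<open>If every small circle around 1 met the fibre over \<open>p\<close> on the unit circle, then
  \<open>(\<phi> z - p) * cnj (\<phi> (cnj z) - p)\<close> would vanish on an arc, and a finite product of
  rotations of this function on the whole unit circle, hence at 0.\<close>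

lemma exists_radius_avoiding_value:
  fixes \<phi> :: "complex \<Rightarrow> complex"
  assumes cont: "continuous_on (cball 0 1) \<phi>" and hol: "\<phi> holomorphic_on ball 0 1"
    and p: "p \<notin> \<phi> ` ball 0 1" "\<phi> 1 = p" and r0: "0 < r0"
  obtains r where "0 < r" "r < r0" "\<And>z. z \<in> cball 0 1 \<Longrightarrow> cmod (z - 1) = r \<Longrightarrow> \<phi> z \<noteq> p"
proof -
  have "\<exists>r>0. r < r0 \<and> (\<forall>z\<in>cball 0 1. cmod (z - 1) = r \<longrightarrow> \<phi> z \<noteq> p)"
  proof (rule ccontr)
    assume "\<not> ?thesis"
    then have ex: "\<exists>z\<in>cball 0 1. cmod (z - 1) = r \<and> \<phi> z = p" if "0 < r" "r < r0" for r
      using that by blast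
    define F where "F z = (\<phi> z - p) * cnj (\<phi> (cnj z) - p)" for z
    have F0: "F u = 0" if u: "cmod u = 1" "cmod (u - 1) < r0" for u
    proof (cases "u = 1")
      case True
      then show ?thesis using p by (simp add: F_def)
    next
      case False
      then obtain z where z: "cmod z \<le> 1" "cmod (z - 1) = cmod (u - 1)" "\<phi> z = p"
        using ex[of "cmod (u - 1)"] u by auto
      have z1: "cmod z = 1" using z p(1) by (metis image_eqI less_eq_real_def mem_ball_0)
      \<comment> \<open>On the unit circle the distance to 1 determines the real part, so
        \<open>z\<close> is \<open>u\<close> or its conjugate; the two factors of \<open>F\<close>
        cover the two cases.\<close>
      have Re: "Re z = Re u" using dist_one_unit_circle[OF z1] dist_one_unit_circle[OF u(1)] z(2) by simp
      have "(Re z)\<^sup>2 + (Im z)\<^sup>2 = (Re u)\<^sup>2 + (Im u)\<^sup>2" using z1 u(1) by (metis cmod_power2)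
      then have "Im z = Im u \<or> Im z = - Im u" using Re by (simp add: power2_eq_iff)
      then have "u = z \<or> cnj u = z" using Re by (auto simp: complex_eq_iff)
      then show ?thesis using z(3) by (auto simp: F_def)
    qed
    have Fcont: "continuous_on (cball 0 1) F"
    proof -
      have "continuous_on (cball 0 1) (\<lambda>z. \<phi> (cnj z))"
        by (rule continuous_on_compose2[OF cont]) (auto intro!: continuous_intros)
      then show ?thesis unfolding F_def using cont by (intro continuous_intros)
    qed
    have Fhol: "F holomorphic_on ball 0 1"
    proof -
      have "(cnj \<circ> \<phi> \<circ> cnj) holomorphic_on ball 0 1"
        using hol by (subst holomorphic_on_compose_cnj_cnj) (auto simp: image_iff intro: holomorphic_on_subset)
      then have "(\<lambda>z. (\<phi> z - p) * ((cnj \<circ> \<phi> \<circ> cnj) z - cnj p)) holomorphic_on ball 0 1"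
        using hol by (intro holomorphic_intros)
      then show ?thesis unfolding F_def by simp
    qed
    \<comment> \<open>The rotation step \<open>2 * pi / n\<close> is shorter than \<open>r0\<close>,
      so the rotated copies of the zero arc cover the circle.\<close>
    obtain n :: nat where n: "2 * pi / r0 < real n" using reals_Archimedean2 by blast
    have "0 < 2 * pi / r0" using r0 by simp
    then have npos: "0 < real n" using n by linarith
    then have n2: "2 * pi / n < r0" using n r0 by (simp add: field_simps)
    define G where "G z = (\<Prod>j\<le>n. F (cis (- (2 * pi * j / n)) * z))" for z
    have rot: "cis t * z \<in> cball 0 1 \<longleftrightarrow> z \<in> cball 0 1" "cis t * z \<in> ball 0 1 \<longleftrightarrow> z \<in> ball 0 1" for t z
      by (auto simp: norm_mult)
    have Ghol: "G holomorphic_on ball 0 1"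
      unfolding G_def
      by (intro holomorphic_on_prod holomorphic_on_compose_gen[OF _ Fhol, unfolded o_def] holomorphic_intros)
         (use rot in auto)
    have Gcont: "continuous_on (cball 0 1) G"
      unfolding G_def
      by (intro continuous_on_prod continuous_on_compose2[OF Fcont] continuous_intros) (use rot in auto)
    have G0: "G u = 0" if u: "cmod u = 1" for u
    proof -
      define \<theta> where "\<theta> = Arg2pi u"
      have th: "0 \<le> \<theta>" "\<theta> < 2 * pi" "u = cis \<theta>"
        using u Arg2pi[of u] by (auto simp: \<theta>_def cis_conv_exp is_Arg_def)
      define x where "x = real n * \<theta> / (2 * pi)"
      have x: "0 \<le> x" "x < n" using th npos by (auto simp: x_def field_simps)
      \<comment> \<open>Rotating \<open>u\<close> back by the largest multiple of the step below its
        argument leaves an angle between 0 and \<open>2 * pi / n\<close>.\<close>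
      define j where "j = nat \<lfloor>x\<rfloor>"
      have j: "real j \<le> x" "x < real j + 1" using x unfolding j_def by linarith+
      have jn: "j \<le> n" using j x by linarith
      define t where "t = \<theta> - 2 * pi * j / n"
      have "t = 2 * pi / n * (x - j)" using npos by (simp add: t_def x_def field_simps)
      then have "\<bar>t\<bar> = 2 * pi / n * (x - j)" using j npos by simp
      also have "\<dots> \<le> 2 * pi / n * 1" using j npos by (intro mult_left_mono) auto
      finally have "\<bar>t\<bar> < r0" using n2 by simp
      moreover have "cmod (cis t - 1) \<le> \<bar>t\<bar>"
      proof -
        have "cmod (cis t - 1) = 2 * \<bar>sin (t / 2)\<bar>" using dist_exp_i_1[of t] by (simp add: cis_conv_exp)
        also have "\<dots> \<le> 2 * \<bar>t / 2\<bar>" by (intro mult_left_mono abs_sin_x_le_abs_x) simp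
        finally show ?thesis by simp
      qed
      ultimately have "F (cis t) = 0" by (intro F0) auto
      moreover have "cis (- (2 * pi * j / n)) * u = cis t" by (simp add: th(3) cis_mult t_def)
      ultimately show ?thesis using jn unfolding G_def by (intro prod_zero) (auto intro!: bexI[of _ j])
    qed
    have "cmod (G 0) \<le> 0"
      by (rule maximum_modulus_frontier[of G "ball 0 1"]) (use Ghol Gcont G0 in auto)
    \<comment> \<open>At the centre all factors of \<open>G\<close> equal \<open>F 0\<close>, which
      is the squared modulus of \<open>\<phi> 0 - p\<close>.\<close>
    then have "F 0 = 0" by (auto simp: G_def)
    then have "\<phi> 0 = p" by (simp add: F_def)
    then show False using p(1) by force
  qed
  then show ?thesis using that by blast
qed

text \<open>\<open>K\<close> need not be convex, so bounding the derivative on \<open>K\<close> is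
  not enough. Pairs that violate the constant \<open>n\<close> are at most \<open>2 * B / n\<close>
  apart, hence accumulate at one point, and on a disc about it convexity does give a Lipschitz
  bound.\<close>

lemma holomorphic_lipschitz_on_compact:
  fixes g :: "complex \<Rightarrow> complex"
  assumes hol: "g holomorphic_on U" and U: "open U" and K: "compact K" "K \<subseteq> U"
  obtains L where "L-lipschitz_on K g"
proof (rule ccontr)
  assume "\<not> thesis"
  then have no: "\<not> L-lipschitz_on K g" for L using that by blast
  have "\<exists>x\<in>K. \<exists>y\<in>K. real n * cmod (x - y) < cmod (g x - g y)" for n
    using no[of "real n"] unfolding lipschitz_on_def dist_norm by (meson not_le of_nat_0_le_iff)
  then obtain x y where xy: "\<And>n. x n \<in> K" "\<And>n. y n \<in> K" "\<And>n. real n * cmod (x n - y n) < cmod (g (x n) - g (y n))"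
    by metis
  have "compact (g ` K)"
    using hol K holomorphic_on_imp_continuous_on continuous_on_subset by (metis compact_continuous_image)
  then obtain B where B: "\<And>z. z \<in> K \<Longrightarrow> cmod (g z) \<le> B" 
    by (metis bounded_iff compact_imp_bounded imageI)
  obtain l s where l: "l \<in> K" "strict_mono s" "(x \<circ> s) \<longlonglongrightarrow> l"
    using K(1) xy(1) unfolding compact_def by metis
  have d0: "(\<lambda>n. x n - y n) \<longlonglongrightarrow> 0"
  proof (rule Lim_null_comparison)
    show "\<forall>\<^sub>F n in sequentially. cmod (x n - y n) \<le> 2 * B / real n"
    proof (rule eventually_mono[OF eventually_gt_at_top[of 0]])
      fix n :: nat assume n: "n > 0"
      have "cmod (g (x n) - g (y n)) \<le> 2 * B"
        using norm_triangle_ineq4[of "g (x n)" "g (y n)"] B[OF xy(1)[of n]] B[OF xy(2)[of n]] by linarith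
      then show "cmod (x n - y n) \<le> 2 * B / real n" using xy(3)[of n] n by (simp add: field_simps)
    qed
    show "(\<lambda>n. 2 * B / real n) \<longlonglongrightarrow> 0" by real_asymp
  qed
  have "(\<lambda>n. (x \<circ> s) n - ((\<lambda>n. x n - y n) \<circ> s) n) \<longlonglongrightarrow> l - 0"
    by (intro tendsto_diff l LIMSEQ_subseq_LIMSEQ[OF d0])
  then have yl: "(y \<circ> s) \<longlonglongrightarrow> l" by (simp add: o_def)
  obtain e where e: "e > 0" "cball l e \<subseteq> U" using U K l open_contains_cball by blast
  have "compact (deriv g ` cball l e)"
    using hol e U by (intro compact_continuous_image holomorphic_on_imp_continuous_on holomorphic_on_subset[OF holomorphic_deriv]) auto
  then obtain D where D: "\<And>z. z \<in> cball l e \<Longrightarrow> cmod (deriv g z) \<le> D"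
    by (metis bounded_iff compact_imp_bounded imageI)
  have "\<forall>\<^sub>F n in sequentially. (x \<circ> s) n \<in> ball l e" "\<forall>\<^sub>F n in sequentially. (y \<circ> s) n \<in> ball l e"
    using tendstoD[OF l(3) e(1)] tendstoD[OF yl e(1)] by (simp_all add: dist_commute)
  moreover have "\<forall>\<^sub>F n in sequentially. D < real (s n)"
    using filterlim_compose[OF filterlim_real_sequentially filterlim_subseq[OF l(2)]]
    by (auto simp: filterlim_at_top_dense)
  ultimately have "\<forall>\<^sub>F n in sequentially. False"
  proof eventually_elim
    case (elim n)
    let ?x = "x (s n)" and ?y = "y (s n)"
    have "cmod (g ?x - g ?y) \<le> D * cmod (?x - ?y)"
    proof (rule field_differentiable_bound[of "cball l e" g "deriv g"])
      show "(g has_field_derivative deriv g z) (at z within cball l e)" if "z \<in> cball l e" for z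
        using hol U e that by (meson holomorphic_derivI has_field_derivative_at_within subsetD)
    qed (use D elim in auto)
    also have "\<dots> \<le> real (s n) * cmod (?x - ?y)" using elim by (intro mult_right_mono) auto
    finally show False using xy(3)[of "s n"] by simp
  qed
  then show False by simp
qed

section \<open>First exit times\<close>

lemma first_exit_aux:
  fixes f :: "real \<Rightarrow> 'a::topological_space"
  assumes ts: "t \<le> s" and cont: "continuous_on {t..s} f" and G: "open G" "f t \<in> G" "f s \<notin> G"
  obtains \<tau> where "t < \<tau>" "\<tau> \<le> s" "f \<tau> \<notin> G" "\<And>u. t \<le> u \<Longrightarrow> u < \<tau> \<Longrightarrow> f u \<in> G"
proof -
  let ?X = "{u \<in> {t..s}. f u \<in> - G}"
  have "closed ({t..s} \<inter> f -` (- G))" using G by (intro continuous_closed_preimage[OF cont]) auto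
  moreover have "{t..s} \<inter> f -` (- G) = ?X" by auto
  ultimately have "closed ?X" by simp
  moreover have "?X \<noteq> {}" "bdd_below ?X" using G ts by (auto intro: bdd_belowI[of _ t])
  ultimately have X: "Inf ?X \<in> ?X" by (rule closed_contains_Inf[rotated -1])
  have "f u \<in> G" if "t \<le> u" "u < Inf ?X" for u
  proof (rule ccontr)
    assume "f u \<notin> G"
    then have "u \<in> ?X" using that X by auto
    then have "Inf ?X \<le> u" using \<open>bdd_below ?X\<close> by (rule cInf_lower)
    then show False using that by simp
  qed
  moreover have "t < Inf ?X" using X G(2) by (metis (mono_tags, lifting) ComplD atLeastAtMost_iff less_eq_real_def mem_Collect_eq)
  ultimately show ?thesis using that X by auto
qed

text \<open>The time \<open>s\<close> may precede \<open>t\<close>, in which case the curve is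
  followed backwards; \<open>closed_segment\<close> treats both orders at once.\<close>

lemma first_exit:
  fixes f :: "real \<Rightarrow> 'a::topological_space"
  assumes cont: "continuous_on (closed_segment t s) f" and G: "open G" "f t \<in> G" "f s \<notin> G"
  obtains \<tau> where "\<tau> \<in> closed_segment t s" "f \<tau> \<notin> G" "\<And>u. u \<in> closed_segment t \<tau> \<Longrightarrow> u \<noteq> \<tau> \<Longrightarrow> f u \<in> G"
proof (cases "t \<le> s")
  case True
  then have "continuous_on {t..s} f" using cont by (simp add: closed_segment_eq_real_ivl)
  from first_exit_aux[OF True this G] obtain \<tau> where
    "t < \<tau>" "\<tau> \<le> s" "f \<tau> \<notin> G" "\<And>u. t \<le> u \<Longrightarrow> u < \<tau> \<Longrightarrow> f u \<in> G" by metis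
  then show ?thesis by (intro that[of \<tau>]) (auto simp: closed_segment_eq_real_ivl)
next
  case False
  then have "continuous_on {-t..-s} (\<lambda>u. f (- u))"
    using cont by (intro continuous_on_compose2[OF cont] continuous_intros) (auto simp: closed_segment_eq_real_ivl)
  moreover have "- t \<le> - s" using False by simp
  ultimately obtain \<tau> where
    "-t < \<tau>" "\<tau> \<le> -s" "f (-\<tau>) \<notin> G" "\<And>u. -t \<le> u \<Longrightarrow> u < \<tau> \<Longrightarrow> f (-u) \<in> G"
    using first_exit_aux[of "-t" "-s" "\<lambda>u. f (- u)" G] G by auto
  note \<tau> = this
  show ?thesis
  proof (rule that[of "-\<tau>"])
    show "- \<tau> \<in> closed_segment t s" using \<tau> False by (auto simp: closed_segment_eq_real_ivl)
    show "f u \<in> G" if "u \<in> closed_segment t (- \<tau>)" "u \<noteq> - \<tau>" for u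
      using \<tau>(4)[of "-u"] that \<tau>(1) by (auto simp: closed_segment_eq_real_ivl split: if_splits)
  qed (rule \<tau>(3))
qed

section \<open>Almost-geodesics in a boundary chart\<close>

lemma disc_chain_nonneg: "disc_chain \<Omega> z w l \<Longrightarrow> 0 \<le> l"
  by (induction rule: disc_chain.induct) (simp_all add: poincare_dist_nonneg)

lemma kobayashi_dist_le_poincare_dist:
  assumes "\<phi> holomorphic_on ball 0 1" "\<phi> ` ball 0 1 \<subseteq> \<Omega>" "a \<in> ball 0 1" "b \<in> ball 0 1"
  shows "kobayashi_dist \<Omega> (\<phi> a) (\<phi> b) \<le> poincare_dist a b"
  unfolding kobayashi_dist_def
proof (rule cInf_lower)
  show "poincare_dist a b \<in> {l. disc_chain \<Omega> (\<phi> a) (\<phi> b) l}"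
    using assms by (simp add: disc_chain.single)
  show "bdd_below {l. disc_chain \<Omega> (\<phi> a) (\<phi> b) l}"
    using disc_chain_nonneg by (intro bdd_belowI[of _ 0]) auto
qed

text \<open>A small affine disc around \<open>z\<close> makes the set of competitors nonempty; only
  then does a bound on the infimum yield an actual disc.\<close>

lemma kobayashi_royden_lessE:
  assumes "open \<Omega>" "z \<in> \<Omega>" "kobayashi_royden \<Omega> z v < B"
  obtains f \<alpha> where "f holomorphic_on ball 0 1" "f ` ball 0 1 \<subseteq> \<Omega>" "f 0 = z" "deriv f 0 * \<alpha> = v" "cmod \<alpha> < B"
proof -
  let ?X = "{cmod \<alpha> |\<alpha>. \<exists>f. f holomorphic_on ball 0 1 \<and> f ` ball 0 1 \<subseteq> \<Omega> \<and> f 0 = z \<and> deriv f 0 * \<alpha> = v}"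
  obtain \<rho> where \<rho>: "\<rho> > 0" "ball z \<rho> \<subseteq> \<Omega>" using assms(1,2) open_contains_ball by blast
  define f where "f w = z + of_real \<rho> * w" for w
  have "deriv f 0 = of_real \<rho>" unfolding f_def
    by (rule DERIV_imp_deriv) (auto intro!: derivative_eq_intros)
  moreover have "f ` ball 0 1 \<subseteq> \<Omega>"
  proof
    fix y assume "y \<in> f ` ball 0 1"
    then obtain w where "cmod w < 1" "y = f w" by auto
    then have "y \<in> ball z \<rho>" using \<rho> by (simp add: f_def dist_norm norm_mult)
    then show "y \<in> \<Omega>" using \<rho> by blast
  qed
  moreover have "f holomorphic_on ball 0 1" unfolding f_def by (intro holomorphic_intros)
  ultimately have "cmod (v / of_real \<rho>) \<in> ?X"
    using \<rho> by (intro CollectI exI[of _ "v / of_real \<rho>"] conjI exI[of _ f]) (auto simp: f_def)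
  then have "?X \<noteq> {}" by blast
  then show ?thesis
    using cInf_lessD[of ?X B] assms(3) that unfolding kobayashi_royden_def by blast
qed

text \<open>Following \<open>h\<close> by the disc automorphism that sends \<open>h 0\<close> to 0
  reduces the claim to the Schwarz lemma.\<close>

lemma Schwarz_Pick_deriv_zero:
  assumes hol: "h holomorphic_on ball 0 1" and into: "h ` ball 0 1 \<subseteq> ball 0 1"
  shows "cmod (deriv h 0) \<le> 1 - (cmod (h 0))\<^sup>2"
proof -
  define c where "c = h 0"
  have c: "cmod c < 1" using into by (auto simp: c_def image_subset_iff)
  then have c2: "(cmod c)\<^sup>2 < 1" by (simp add: abs_square_less_1)
  define k where "k z = Moebius_function 0 c (h z)" for z
  have "k holomorphic_on ball 0 1"
    unfolding k_def using c
    by (intro holomorphic_on_compose_gen[OF hol Moebius_function_holomorphic into, unfolded o_def])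
  moreover have "cmod (k z) < 1" if "cmod z < 1" for z
    using that into c unfolding k_def by (intro Moebius_function_norm_lt_1) (auto simp: image_subset_iff)
  moreover have "k 0 = 0" by (simp add: k_def c_def Moebius_function_eq_zero)
  ultimately have k1: "cmod (deriv k 0) \<le> 1" by (intro Schwarz_Lemma(2)[of k 0]) auto
  have cc: "c * cnj c = of_real ((cmod c)\<^sup>2)" by (simp add: complex_norm_square[symmetric])
  then have cc': "cnj c * c = of_real ((cmod c)\<^sup>2)" by (simp add: mult.commute)
  have nz: "1 - cnj c * c \<noteq> 0" using c2 unfolding cc' by (metis eq_iff_diff_eq_0 less_irrefl of_real_eq_1_iff)
  have hd: "(h has_field_derivative deriv h 0) (at 0)"
    using hol holomorphic_derivI[OF hol, of 0] by simp
  have "((\<lambda>z. (z - c) / (1 - cnj c * z)) has_field_derivative 1 / (1 - cnj c * c)) (at c)"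
    using nz by (auto intro!: derivative_eq_intros simp: divide_simps)
  then have "((\<lambda>z. (h z - c) / (1 - cnj c * h z)) has_field_derivative 1 / (1 - cnj c * c) * deriv h 0) (at 0)"
    using hd unfolding c_def by (intro DERIV_chain2[where f = "\<lambda>z. (z - h 0) / (1 - cnj (h 0) * z)"]) 
  then have "deriv k 0 = deriv h 0 / (1 - cnj c * c)"
    unfolding k_def Moebius_function_simple by (auto dest: DERIV_imp_deriv)
  then have "cmod (deriv k 0) = cmod (deriv h 0) / (1 - (cmod c)\<^sup>2)"
    using c2 unfolding cc' by (metis abs_of_pos diff_gt_0_iff_gt norm_divide norm_of_real of_real_1 of_real_diff)
  then show ?thesis using k1 c2 by (simp add: c_def field_simps)
qed

section \<open>Charts at a boundary point\<close>

definition lens :: "real \<Rightarrow> complex set" where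
  "lens s = ball 0 1 \<inter> ball 1 s"

text \<open>The last two assumptions replace injectivity on the circle. By \<open>arc\<close>, a
  point of \<open>\<Omega>\<close> in the image of the closed lens comes from the open disc; by
  \<open>avoid\<close>, the image of the circular crosscut of radius \<open>r\<close> has positive
  distance from \<open>\<phi> 1\<close>.\<close>

locale boundary_chart =
  fixes \<Omega> :: "complex set" and \<phi> :: "complex \<Rightarrow> complex" and r :: real
  assumes open_domain: "open \<Omega>"
    and cont: "continuous_on (cball 0 1) \<phi>" and hol: "\<phi> holomorphic_on ball 0 1"
    and inj: "inj_on \<phi> (ball 0 1)" and into: "\<phi> ` ball 0 1 \<subseteq> \<Omega>"
    and r: "0 < r" "r < 1"
    and arc: "\<phi> ` (sphere 0 1 \<inter> cball 1 r) \<subseteq> frontier \<Omega>"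
    and avoid: "z \<in> cball 0 1 \<Longrightarrow> cmod (z - 1) = r \<Longrightarrow> \<phi> z \<noteq> \<phi> 1"
begin

abbreviation g where "g \<equiv> inv_into (ball 0 1) \<phi>"

lemma arc_notin: "z \<in> sphere 0 1 \<Longrightarrow> cmod (z - 1) \<le> r \<Longrightarrow> \<phi> z \<notin> \<Omega>"
  using arc open_domain by (auto simp: frontier_def interior_open image_subset_iff dist_norm norm_minus_commute)

lemma g_inverse: "w \<in> ball 0 1 \<Longrightarrow> g (\<phi> w) = w"
  using inj by (rule inv_into_f_f)

lemma open_image: "A \<subseteq> ball 0 1 \<Longrightarrow> open A \<Longrightarrow> open (\<phi> ` A)"
  by (rule open_mapping_thm3) (auto intro: holomorphic_on_subset[OF hol] inj_on_subset[OF inj])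

lemma g_holomorphic: "g holomorphic_on \<phi> ` ball 0 1"
proof -
  obtain k where "k holomorphic_on \<phi> ` ball 0 1" "\<And>z. z \<in> ball 0 1 \<Longrightarrow> k (\<phi> z) = z"
    using holomorphic_has_inverse[OF hol open_ball inj] by metis
  then show ?thesis using g_inverse by (subst holomorphic_cong[of _ _ g k]) auto
qed

lemma image_closed_lens_Int:
  assumes "s \<le> r" "x \<in> \<Omega>" "x \<in> \<phi> ` (cball 0 1 \<inter> cball 1 s)"
  obtains w where "x = \<phi> w" "w \<in> ball 0 1" "cmod (w - 1) \<le> s"
proof -
  obtain w where w: "x = \<phi> w" "cmod w \<le> 1" "cmod (w - 1) \<le> s"
    using assms(3) by (auto simp: dist_norm norm_minus_commute)
  then have "cmod w \<noteq> 1" using arc_notin[of w] assms by auto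
  then show ?thesis using that[of w] w by simp
qed

text \<open>A connected subset of \<open>\<Omega>\<close> can leave the image of the lens only
  through the image of the crosscut, because the arc is mapped outside \<open>\<Omega>\<close>; and
  the crosscut image stays at distance \<open>m\<close> from \<open>\<phi> 1\<close>.\<close>

lemma connected_near_in_image_lens:
  obtains m where "0 < m" "\<And>A. connected A \<Longrightarrow> A \<subseteq> \<Omega> \<Longrightarrow> A \<inter> \<phi> ` lens r \<noteq> {} \<Longrightarrow>
    (\<And>a. a \<in> A \<Longrightarrow> cmod (a - \<phi> 1) < m) \<Longrightarrow> A \<subseteq> \<phi> ` lens r"
proof -
  let ?C = "\<phi> ` (cball 0 1 \<inter> sphere 1 r)"
  have "compact ?C"
    by (intro compact_continuous_image continuous_on_subset[OF cont] compact_Int) auto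
  then have "open (- ?C)" by (simp add: compact_imp_closed open_Compl)
  moreover have "\<phi> 1 \<in> - ?C" using avoid by (force simp: dist_norm norm_minus_commute)
  ultimately obtain m where m: "0 < m" "ball (\<phi> 1) m \<subseteq> - ?C"
    by (rule openE)
  have "A \<subseteq> \<phi> ` lens r"
    if A: "connected A" "A \<subseteq> \<Omega>" "A \<inter> \<phi> ` lens r \<noteq> {}" "\<And>a. a \<in> A \<Longrightarrow> cmod (a - \<phi> 1) < m" for A
  proof -
    let ?K = "\<phi> ` (cball 0 1 \<inter> cball 1 r)"
    have "compact ?K"
      by (intro compact_continuous_image continuous_on_subset[OF cont] compact_Int) auto
    then have "closedin (top_of_set A) (A \<inter> ?K)" by (simp add: closedin_closed_Int compact_imp_closed)
    \<comment> \<open>Compactness gives closedness of the left side and the open mapping theorem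
      openness of the right side. They agree because points of \<open>A\<close> come neither from
      the arc nor from the crosscut.\<close>
    moreover have "A \<inter> ?K = A \<inter> \<phi> ` lens r"
    proof
      show "A \<inter> \<phi> ` lens r \<subseteq> A \<inter> ?K" using ball_subset_cball by (auto simp: lens_def)
      show "A \<inter> ?K \<subseteq> A \<inter> \<phi> ` lens r"
      proof
        fix x assume x: "x \<in> A \<inter> ?K"
        then obtain w where w: "x = \<phi> w" "w \<in> ball 0 1" "cmod (w - 1) \<le> r"
          using image_closed_lens_Int[of r x] A(2) by blast
        have "x \<in> ball (\<phi> 1) m" using A(4) x by (simp add: dist_norm norm_minus_commute)
        then have "x \<notin> ?C" using m by blast
        then have "cmod (w - 1) \<noteq> r" using w by (auto simp: dist_norm norm_minus_commute)
        then show "x \<in> A \<inter> \<phi> ` lens r" using w x by (auto simp: lens_def dist_norm norm_minus_commute)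
      qed
    qed
    moreover have "openin (top_of_set A) (A \<inter> \<phi> ` lens r)"
      by (intro openin_open_Int open_image) (auto simp: lens_def)
    ultimately have "A \<inter> \<phi> ` lens r = A" using A(1,3) unfolding connected_clopen by metis
    then show ?thesis by blast
  qed
  then show ?thesis using that m by blast
qed

text \<open>The factor 16 is the product of 2 for a nearly optimal disc, 4 for its restriction to a
  quarter of the radius, and 2 from \<open>1 - (cmod w)\<^sup>2 \<le> 2 * (1 - cmod w)\<close>. The
  radius \<open>r1\<close> is small enough that the centre of the disc is within the
  \<open>\<eta>\<close> of \<open>omitting_two_values_close\<close>.\<close>

lemma chart_speed_bound:
  obtains r1 where "0 < r1" "r1 < r"
    "\<And>w v K. w \<in> ball 0 1 \<Longrightarrow> cmod (w - 1) \<le> r1 \<Longrightarrow> 1 \<le> K \<Longrightarrow> kobayashi_royden \<Omega> (\<phi> w) v \<le> K \<Longrightarrow>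
       cmod (deriv g (\<phi> w) * v) \<le> 16 * K * (1 - cmod w)"
proof -
  obtain m where m: "0 < m" and near: "\<And>A. connected A \<Longrightarrow> A \<subseteq> \<Omega> \<Longrightarrow> A \<inter> \<phi> ` lens r \<noteq> {} \<Longrightarrow>
    (\<And>a. a \<in> A \<Longrightarrow> cmod (a - \<phi> 1) < m) \<Longrightarrow> A \<subseteq> \<phi> ` lens r"
    using connected_near_in_image_lens by blast
  \<comment> \<open>An endpoint of the crosscut: \<open>arc\<close> puts \<open>\<phi> u\<close>
    outside \<open>\<Omega>\<close> and \<open>avoid\<close> separates it from
    \<open>\<phi> 1\<close>, so it is the second omitted value. Its real part is forced by
    \<open>dist_one_unit_circle\<close>.\<close>
  obtain u where u: "cmod u = 1" "cmod (u - 1) = r"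
  proof
    define x where "x = 1 - r\<^sup>2 / 2"
    have "r\<^sup>2 \<le> 1" using r by (simp add: power_le_one)
    then have x: "x\<^sup>2 \<le> 1" unfolding x_def by (intro power_le_one) auto
    let ?u = "Complex x (sqrt (1 - x\<^sup>2))"
    show u1: "cmod ?u = 1" using x by (simp add: cmod_def)
    have "(cmod (?u - 1))\<^sup>2 = r\<^sup>2" by (subst dist_one_unit_circle[OF u1]) (simp add: x_def)
    then show "cmod (?u - 1) = r" using r by (simp add: power2_eq_iff_nonneg)
  qed
  have q: "\<phi> u \<notin> \<Omega>" "\<phi> 1 \<noteq> \<phi> u" and p: "\<phi> 1 \<notin> \<Omega>"
    using arc_notin[of u] arc_notin[of 1] avoid[of u] u r by auto
  obtain \<eta> where \<eta>: "0 < \<eta>" and omit: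
    "\<And>f z. f holomorphic_on ball 0 1 \<Longrightarrow> \<phi> 1 \<notin> f ` ball 0 1 \<Longrightarrow> \<phi> u \<notin> f ` ball 0 1 \<Longrightarrow>
       cmod (f 0 - \<phi> 1) < \<eta> \<Longrightarrow> cmod z \<le> 1 / 4 \<Longrightarrow> cmod (f z - \<phi> 1) < m"
    using omitting_two_values_close[OF q(2) m] by metis
  have "(1::complex) \<in> cball 0 1" by simp
  then obtain d where d: "0 < d" "\<And>w. w \<in> cball 0 1 \<Longrightarrow> dist w 1 < d \<Longrightarrow> dist (\<phi> w) (\<phi> 1) < \<eta>"
    using cont \<eta> unfolding continuous_on_iff by metis
  define r1 where "r1 = min d r / 2"
  have r1: "0 < r1" "r1 < r" "r1 < d" using d r by (auto simp: r1_def)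
  have "cmod (deriv g (\<phi> w) * v) \<le> 16 * K * (1 - cmod w)"
    if w: "w \<in> ball 0 1" "cmod (w - 1) \<le> r1" and K: "1 \<le> K" "kobayashi_royden \<Omega> (\<phi> w) v \<le> K" for w v K
  proof -
    have "\<phi> w \<in> \<Omega>" using w into by blast
    moreover have "kobayashi_royden \<Omega> (\<phi> w) v < 2 * K" using K by simp
    ultimately obtain f \<alpha> where f: "f holomorphic_on ball 0 1" "f ` ball 0 1 \<subseteq> \<Omega>" "f 0 = \<phi> w"
      "deriv f 0 * \<alpha> = v" "cmod \<alpha> < 2 * K"
      using kobayashi_royden_lessE[OF open_domain] by metis
    have f0: "cmod (f 0 - \<phi> 1) < \<eta>" using d(2)[of w] w r1 f by (simp add: dist_norm)
    let ?A = "f ` ball 0 (1/4)"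
    have sub: "ball 0 (1/4) \<subseteq> (ball 0 1 :: complex set)" by auto
    have A: "?A \<subseteq> \<phi> ` lens r"
    proof (rule near)
      show "connected ?A"
        using holomorphic_on_imp_continuous_on[OF f(1)] sub continuous_on_subset
        by (intro connected_continuous_image) auto
      show "?A \<subseteq> \<Omega>" using f(2) sub by blast
      have "\<phi> w \<in> ?A" by (rule image_eqI[of _ _ 0]) (auto simp: f)
      moreover have "\<phi> w \<in> \<phi> ` lens r" using w r1 by (auto simp: lens_def dist_norm norm_minus_commute)
      ultimately show "?A \<inter> \<phi> ` lens r \<noteq> {}" by blast
      show "cmod (a - \<phi> 1) < m" if a: "a \<in> ?A" for a
      proof -
        obtain z where z: "a = f z" "cmod z < 1/4" using a by auto
        show ?thesis unfolding z(1) by (rule omit[OF f(1) _ _ f0]) (use f(2) p q z in auto)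
      qed
    qed
    define h where "h z = g (f (z / 4))" for z
    have scal: "z / 4 \<in> ball 0 (1/4)" if "z \<in> ball 0 1" for z :: complex
      using that by (simp add: norm_divide)
    have lensb: "\<phi> ` lens r \<subseteq> \<phi> ` ball 0 1" by (auto simp: lens_def)
    have "(\<lambda>z. f (z / 4)) holomorphic_on ball 0 1"
      by (rule holomorphic_on_compose_gen[OF _ f(1), unfolded o_def]) (auto intro!: holomorphic_intros simp: norm_divide)
    moreover have "(\<lambda>z. f (z / 4)) ` ball 0 1 \<subseteq> \<phi> ` ball 0 1"
      using scal A lensb by blast
    ultimately have hh: "h holomorphic_on ball 0 1"
      unfolding h_def by (rule holomorphic_on_compose_gen[OF _ g_holomorphic, unfolded o_def])
    have hb: "h ` ball 0 1 \<subseteq> ball 0 1"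
    proof
      fix y assume "y \<in> h ` ball 0 1"
      then obtain z where z: "z \<in> ball 0 1" "y = h z" by blast
      then obtain w' where "w' \<in> ball 0 1" "f (z / 4) = \<phi> w'" using scal[OF z(1)] A lensb by blast
      then show "y \<in> ball 0 1" using z g_inverse by (simp add: h_def)
    qed
    have h0: "h 0 = w" using w g_inverse f(3) by (simp add: h_def)
    have "(f has_field_derivative deriv f 0) (at (0 / 4))"
      using holomorphic_derivI[OF f(1), of 0] by simp
    then have "((\<lambda>z. f (z / 4)) has_field_derivative deriv f 0 * (1 / 4)) (at 0)"
      by (rule DERIV_chain2) (auto intro!: derivative_eq_intros)
    moreover have "open (\<phi> ` ball 0 1)" by (intro open_image) auto
    then have "(g has_field_derivative deriv g (\<phi> w)) (at (f (0 / 4)))"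
      using holomorphic_derivI[OF g_holomorphic, of "\<phi> w"] w f(3) by auto
    ultimately have "(h has_field_derivative deriv g (\<phi> w) * (deriv f 0 * (1 / 4))) (at 0)"
      unfolding h_def by (intro DERIV_chain2[where f = g])
    then have "cmod (deriv g (\<phi> w) * (deriv f 0 * (1 / 4))) \<le> 1 - (cmod w)\<^sup>2"
      using Schwarz_Pick_deriv_zero[OF hh hb] h0 DERIV_imp_deriv by metis
    also have "\<dots> = (1 + cmod w) * (1 - cmod w)" by (simp add: power2_eq_square algebra_simps)
    also have "\<dots> \<le> 2 * (1 - cmod w)" using w by (intro mult_right_mono) auto
    finally have "cmod (deriv g (\<phi> w) * deriv f 0) \<le> 8 * (1 - cmod w)"
      by (simp add: norm_mult)
    then have "cmod (deriv g (\<phi> w) * deriv f 0) * cmod \<alpha> \<le> 8 * (1 - cmod w) * (2 * K)"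
      using f(5) K w by (intro mult_mono) auto
    moreover have "cmod (deriv g (\<phi> w) * v) = cmod (deriv g (\<phi> w) * deriv f 0) * cmod \<alpha>"
      using f(4) by (metis mult.assoc norm_mult)
    moreover have "8 * (1 - cmod w) * (2 * K) = 16 * K * (1 - cmod w)" by simp
    ultimately show ?thesis by linarith
  qed
  then show ?thesis using that r1 by blast
qed

text \<open>Up to the first exit from the image of the lens the curve lifts to the disc, and the
  lift ends on the circle of radius \<open>rr\<close> about 1. Its Euclidean displacement is bounded
  by \<open>disc_quasi_geodesic_diameter\<close> with speed constant \<open>16 * \<Lambda>\<close>
  and time constant \<open>\<Lambda>\<close>, whence \<open>64 * \<Lambda>\<^sup>2\<close>.\<close>

lemma almost_geodesic_exit:
  assumes r1: "0 < r1" "r1 < r"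
    and speed: "\<And>w v K. w \<in> ball 0 1 \<Longrightarrow> cmod (w - 1) \<le> r1 \<Longrightarrow> 1 \<le> K \<Longrightarrow>
       kobayashi_royden \<Omega> (\<phi> w) v \<le> K \<Longrightarrow> cmod (deriv g (\<phi> w) * v) \<le> 16 * K * (1 - cmod w)"
    and ag: "almost_geodesic \<Omega> \<Lambda> \<kappa> {0..T} \<sigma>" and \<Lambda>: "1 \<le> \<Lambda>"
    and rr: "0 < rr" "rr \<le> r1"
    and t: "t \<in> {0..T}" "\<sigma> t \<in> \<phi> ` lens rr" and s: "s \<in> {0..T}" "\<sigma> s \<notin> \<phi> ` lens rr"
    and close: "\<And>u w. u \<in> {0..T} \<Longrightarrow> w \<in> ball 0 1 \<Longrightarrow> \<sigma> u = \<phi> w \<Longrightarrow> 1 - cmod w \<le> \<delta>"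
  shows "rr \<le> cmod (g (\<sigma> t) - 1) + 64 * \<Lambda>\<^sup>2 * sqrt (4 * exp \<kappa> * \<delta>)"
proof -
  have \<sigma>\<Omega>: "\<sigma> u \<in> \<Omega>" if "u \<in> {0..T}" for u using ag that unfolding almost_geodesic_def by blast
  have ac: "absolutely_continuous_on {0..T} \<sigma>" using ag unfolding almost_geodesic_def by blast
  have c\<sigma>: "continuous_on {0..T} \<sigma>"
    using ac is_interval_cc by (rule absolutely_continuous_on_imp_continuous_on)
  have seg: "closed_segment t s \<subseteq> {0..T}" using t s by (auto simp: closed_segment_eq_real_ivl)
  have oG: "open (\<phi> ` lens rr)" by (intro open_image) (auto simp: lens_def)
  obtain \<tau> where \<tau>: "\<tau> \<in> closed_segment t s" "\<sigma> \<tau> \<notin> \<phi> ` lens rr"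
    and before: "\<And>u. u \<in> closed_segment t \<tau> \<Longrightarrow> u \<noteq> \<tau> \<Longrightarrow> \<sigma> u \<in> \<phi> ` lens rr"
    using first_exit[OF continuous_on_subset[OF c\<sigma> seg] oG t(2) s(2)] by metis
  define a b where "a = min t \<tau>" and "b = max t \<tau>"
  have ab: "a \<le> b" "closed_segment t \<tau> = {a..b}" "{a..b} \<subseteq> {0..T}"
    using t \<tau> seg by (auto simp: a_def b_def closed_segment_eq_real_ivl split: if_splits)
  have \<tau>T: "\<tau> \<in> {0..T}" using \<tau> seg by blast
  have tn: "t \<noteq> \<tau>" using t(2) \<tau>(2) by auto
  \<comment> \<open>At the exit time itself the curve is only a limit of points in the image of the
    lens. It therefore lies in the compact image of the closed lens, and being in
    \<open>\<Omega>\<close> it still lifts to the open disc.\<close>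
  have "\<tau> \<in> closure (closed_segment t \<tau> - {\<tau>})"
  proof -
    have "\<tau> islimpt {a..b}" using tn by (simp add: a_def b_def islimpt_Icc min_def max_def)
    then show ?thesis using ab(2) by (simp add: islimpt_in_closure)
  qed
  moreover have "closed_segment t \<tau> - {\<tau>} \<subseteq> {a..b} \<inter> \<sigma> -` (\<phi> ` (cball 0 1 \<inter> cball 1 rr))"
    using before ab(2) by (fastforce simp: lens_def)
  moreover have "closed ({a..b} \<inter> \<sigma> -` (\<phi> ` (cball 0 1 \<inter> cball 1 rr)))"
    by (intro continuous_closed_preimage compact_imp_closed compact_continuous_image
        continuous_on_subset[OF cont] continuous_on_subset[OF c\<sigma> ab(3)] compact_Int) auto
  ultimately have "\<sigma> \<tau> \<in> \<phi> ` (cball 0 1 \<inter> cball 1 rr)" by (meson IntE closure_minimal subsetD vimageE)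
  then obtain w\<tau> where w\<tau>: "\<sigma> \<tau> = \<phi> w\<tau>" "w\<tau> \<in> ball 0 1" "cmod (w\<tau> - 1) \<le> rr"
    using image_closed_lens_Int[of rr "\<sigma> \<tau>"] \<sigma>\<Omega>[OF \<tau>T] r1 rr by auto
  then have w\<tau>r: "cmod (w\<tau> - 1) = rr" using \<tau>(2) by (force simp: lens_def dist_norm norm_minus_commute)
  have lift: "\<exists>w. \<sigma> u = \<phi> w \<and> w \<in> ball 0 1 \<and> cmod (w - 1) \<le> rr" if u: "u \<in> {a..b}" for u
  proof (cases "u = \<tau>")
    case True
    then show ?thesis using w\<tau> by blast
  next
    case False
    then have "\<sigma> u \<in> \<phi> ` lens rr" using before u ab(2) by blast
    then show ?thesis by (auto simp: lens_def dist_norm norm_minus_commute less_imp_le)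
  qed
  define \<gamma> where "\<gamma> u = g (\<sigma> u)" for u
  have \<gamma>eq: "g \<circ> \<sigma> = \<gamma>" by (simp add: fun_eq_iff \<gamma>_def)
  have \<gamma>: "\<gamma> u \<in> ball 0 1" "\<phi> (\<gamma> u) = \<sigma> u" "cmod (\<gamma> u - 1) \<le> rr" if "u \<in> {a..b}" for u
    using lift[OF that] g_inverse by (auto simp: \<gamma>_def)
  have im: "\<sigma> ` {a..b} \<subseteq> \<phi> ` ball 0 1" using lift by blast
  have oD: "open (\<phi> ` ball 0 1)" by (intro open_image) auto
  \<comment> \<open>On the compact trace the inverse of the chart is Lipschitz, which carries
    absolute continuity over to the lift.\<close>
  obtain Lc where lip: "Lc-lipschitz_on (\<sigma> ` {a..b}) g"
    using holomorphic_lipschitz_on_compact[OF g_holomorphic oD _ im]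
      compact_continuous_image[OF continuous_on_subset[OF c\<sigma> ab(3)]] by blast
  have ac\<gamma>: "absolutely_continuous_on {a..b} \<gamma>"
    unfolding \<gamma>_def
    by (rule absolutely_continuous_on_compose_lipschitz[OF absolutely_continuous_on_subset[OF ac ab(3)] lip])
  have ae: "AE u in lebesgue. u \<in> {0..T} \<longrightarrow>
        (\<exists>v. (\<sigma> has_vector_derivative v) (at u within {0..T}) \<and> kobayashi_royden \<Omega> (\<sigma> u) v \<le> \<Lambda>)"
    using ag unfolding almost_geodesic_def by blast
  obtain N where Nv': "\<And>u. u \<in> space lebesgue - N \<Longrightarrow> u \<in> {0..T} \<longrightarrow>
        (\<exists>v. (\<sigma> has_vector_derivative v) (at u within {0..T}) \<and> kobayashi_royden \<Omega> (\<sigma> u) v \<le> \<Lambda>)"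
    and N: "N \<in> null_sets lebesgue"
    by (rule AE_E3[OF ae]) (rule that)
  have Nv: "\<exists>v. (\<sigma> has_vector_derivative v) (at u within {0..T}) \<and> kobayashi_royden \<Omega> (\<sigma> u) v \<le> \<Lambda>"
    if "u \<in> {0..T} - N" for u
    using Nv'[of u] that by simp
  have "cmod (\<gamma> b - \<gamma> a) \<le> 4 * \<Lambda> * (16 * \<Lambda>) * sqrt (4 * exp \<kappa> * \<delta>)"
  proof (rule disc_quasi_geodesic_diameter[OF ab(1) ac\<gamma> _ N])
    show "\<gamma> ` {a..b} \<subseteq> ball 0 1" using \<gamma> by blast
    show "\<exists>v. (\<gamma> has_vector_derivative v) (at u within {a..b}) \<and> cmod v \<le> 16 * \<Lambda> * (1 - cmod (\<gamma> u))"
      if u: "u \<in> {a..b} - N" for u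
    proof -
      have u': "u \<in> {0..T} - N" "u \<in> {a..b}" using u ab(3) by auto
      obtain v where v: "(\<sigma> has_vector_derivative v) (at u within {0..T})" "kobayashi_royden \<Omega> (\<sigma> u) v \<le> \<Lambda>"
        using Nv[OF u'(1)] by blast
      have mem: "\<sigma> u \<in> \<phi> ` ball 0 1" using im u'(2) by blast
      have "(g has_field_derivative deriv g (\<sigma> u)) (at (\<sigma> u) within \<sigma> ` {a..b})"
        by (rule has_field_derivative_at_within[OF holomorphic_derivI[OF g_holomorphic oD mem]])
      then have "((g \<circ> \<sigma>) has_vector_derivative v * deriv g (\<sigma> u)) (at u within {a..b})"
        by (rule field_vector_diff_chain_within[OF has_vector_derivative_within_subset[OF v(1) ab(3)]])
      moreover have "cmod (deriv g (\<phi> (\<gamma> u)) * v) \<le> 16 * \<Lambda> * (1 - cmod (\<gamma> u))"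
        using \<gamma>[OF u'(2)] v(2) \<Lambda> rr by (intro speed) auto
      ultimately show ?thesis
        using \<gamma>(2)[OF u'(2)] \<gamma>eq by (intro exI[of _ "v * deriv g (\<sigma> u)"]) (simp add: mult.commute)
    qed
    show "\<bar>u - u'\<bar> \<le> \<Lambda> * (poincare_dist (\<gamma> u) (\<gamma> u') + \<kappa>)" if u: "u \<in> {a..b}" "u' \<in> {a..b}" for u u'
    proof -
      have "1 / \<Lambda> * \<bar>u - u'\<bar> - \<kappa> \<le> kobayashi_dist \<Omega> (\<sigma> u) (\<sigma> u')"
        using ag[unfolded almost_geodesic_def, THEN conjunct2, THEN conjunct2, THEN conjunct1,
          rule_format, OF subsetD[OF ab(3) u(1)] subsetD[OF ab(3) u(2)]] by simp
      also have "\<dots> \<le> poincare_dist (\<gamma> u) (\<gamma> u')"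
        using kobayashi_dist_le_poincare_dist[OF hol into \<gamma>(1)[OF u(1)] \<gamma>(1)[OF u(2)]] \<gamma>(2)[OF u(1)] \<gamma>(2)[OF u(2)] by simp
      finally show ?thesis using \<Lambda> by (simp add: field_simps)
    qed
    show "1 - cmod (\<gamma> u) \<le> \<delta>" if "u \<in> {a..b}" for u
      using close[of u "\<gamma> u"] \<gamma>[OF that] ab(3) that by auto
  qed (use \<Lambda> in auto)
  moreover have "cmod (\<gamma> \<tau> - \<gamma> t) = cmod (\<gamma> b - \<gamma> a)"
    by (auto simp: a_def b_def min_def max_def norm_minus_commute)
  moreover have "\<gamma> \<tau> = w\<tau>" using w\<tau> g_inverse by (simp add: \<gamma>_def)
  moreover have "cmod (w\<tau> - 1) \<le> cmod (\<gamma> \<tau> - \<gamma> t) + cmod (\<gamma> t - 1)"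
    using norm_triangle_ineq[of "\<gamma> \<tau> - \<gamma> t" "\<gamma> t - 1"] \<open>\<gamma> \<tau> = w\<tau>\<close> by simp
  ultimately show ?thesis using w\<tau>r by (simp add: \<gamma>_def power2_eq_square)
qed

end

section \<open>Escaping almost-geodesics\<close>

definition condition2_at :: "complex set \<Rightarrow> complex \<Rightarrow> bool" where
  "condition2_at \<Omega> p \<longleftrightarrow> (\<forall>z::nat \<Rightarrow> complex. range z \<subseteq> \<Omega> \<and> z \<longlonglongrightarrow> p \<longrightarrow>
         (\<exists>(k::nat \<Rightarrow> nat) \<phi> x1 x2.
            strict_mono k \<and>
            continuous_on (cball 0 1) \<phi> \<and> \<phi> holomorphic_on ball 0 1 \<and>
            inj_on \<phi> (ball 0 1) \<and> \<phi> ` ball 0 1 \<subseteq> \<Omega> \<and>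
            x1 \<in> sphere 0 1 \<and> x2 \<in> sphere 0 1 \<and> x1 \<noteq> x2 \<and> x1 \<noteq> 1 \<and> x2 \<noteq> 1 \<and>
            \<phi> 1 = p \<and> \<phi> ` open_arc x1 x2 \<subseteq> frontier \<Omega> \<and>
            (\<forall>n. z (k n) \<in> \<phi> ` arc_region x1 x2) \<and>
            (\<lambda>n. inv_into (ball 0 1) \<phi> (z (k n))) \<longlonglongrightarrow> 1))"

lemma condition2_iff:
  "condition2 \<Omega> \<longleftrightarrow> (\<exists>S. closed S \<and> totally_disconnected S \<and> S \<subseteq> frontier \<Omega> \<and>
     (\<forall>p \<in> frontier \<Omega> - S. condition2_at \<Omega> p))"
  unfolding condition2_def condition2_at_def by (rule refl)

text \<open>A neighbourhood of 1 in the given arc bounds the admissible radii from above, and below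
  this bound \<open>exists_radius_avoiding_value\<close> finds a crosscut that misses the fibre over
  \<open>p\<close>.\<close>

lemma condition2_at_chart:
  assumes \<Omega>: "open \<Omega>" and c2: "condition2_at \<Omega> p"
    and z: "\<And>n. z n \<in> \<Omega>" "z \<longlonglongrightarrow> p"
  obtains k :: "nat \<Rightarrow> nat" and \<phi> r where "strict_mono k" "boundary_chart \<Omega> \<phi> r" "\<phi> 1 = p"
    "\<And>n. z (k n) \<in> \<phi> ` ball 0 1" "(\<lambda>n. inv_into (ball 0 1) \<phi> (z (k n))) \<longlonglongrightarrow> 1"
proof -
  have "range z \<subseteq> \<Omega> \<and> z \<longlonglongrightarrow> p" using z by auto
  then obtain k \<phi> x1 x2 where k: "strict_mono (k::nat \<Rightarrow> nat)"
    and \<phi>: "continuous_on (cball 0 1) \<phi>" "\<phi> holomorphic_on ball 0 1" "inj_on \<phi> (ball 0 1)" "\<phi> ` ball 0 1 \<subseteq> \<Omega>"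
    and x: "x1 \<in> sphere 0 1" "x2 \<in> sphere 0 1" "x1 \<noteq> 1" "x2 \<noteq> 1"
    and p: "\<phi> 1 = p" "\<phi> ` open_arc x1 x2 \<subseteq> frontier \<Omega>"
    and zk: "\<And>n. z (k n) \<in> \<phi> ` arc_region x1 x2" "(\<lambda>n. inv_into (ball 0 1) \<phi> (z (k n))) \<longlonglongrightarrow> 1"
    using c2[unfolded condition2_at_def, rule_format, of z] by blast
  obtain r0 where r0: "0 < r0" "sphere 0 1 \<inter> ball 1 r0 \<subseteq> open_arc x1 x2"
    using open_arc_contains_nhd[OF x(3,4)] by blast
  have "1 \<in> open_arc x1 x2" using r0 by auto
  then have "p \<in> frontier \<Omega>" using p by blast
  then have "p \<notin> \<Omega>" using \<Omega> by (simp add: frontier_def interior_open)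
  then have "p \<notin> \<phi> ` ball 0 1" using \<phi>(4) by blast
  moreover have "0 < min r0 1" using r0 by simp
  ultimately obtain r where r: "0 < r" "r < min r0 1" "\<And>z. z \<in> cball 0 1 \<Longrightarrow> cmod (z - 1) = r \<Longrightarrow> \<phi> z \<noteq> p"
    using exists_radius_avoiding_value[OF \<phi>(1,2) _ p(1)] by blast
  have "sphere 0 1 \<inter> cball 1 r \<subseteq> open_arc x1 x2"
    using r0(2) r(2) by (auto simp: subset_iff)
  then have "\<phi> ` (sphere 0 1 \<inter> cball 1 r) \<subseteq> frontier \<Omega>" using p(2) by blast
  then have "boundary_chart \<Omega> \<phi> r"
    using \<Omega> \<phi> r p(1) by unfold_locales auto
  moreover have "z (k n) \<in> \<phi> ` ball 0 1" for n
    using zk(1)[of n] arc_region_subset_ball[OF x(1,2)] by blast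
  ultimately show ?thesis using that k p(1) zk(2) by blast
qed

definition escaping :: "complex set \<Rightarrow> (nat \<Rightarrow> real \<Rightarrow> complex) \<Rightarrow> (nat \<Rightarrow> real) \<Rightarrow> bool" where
  "escaping \<Omega> \<sigma> T \<longleftrightarrow>
     (\<forall>C. compact C \<and> C \<subseteq> \<Omega> \<longrightarrow> (\<forall>\<^sub>F n in sequentially. \<sigma> n ` {0..T n} \<inter> C = {}))"

lemma eventually_subseq_compose:
  assumes "strict_mono (k :: nat \<Rightarrow> nat)" "\<forall>\<^sub>F n in sequentially. P n"
  shows "\<forall>\<^sub>F n in sequentially. P (k n)"
  using assms eventually_subseq by blast

lemma escaping_subseq:
  assumes "escaping \<Omega> \<sigma> T" "strict_mono k"
  shows "escaping \<Omega> (\<lambda>n. \<sigma> (k n)) (\<lambda>n. T (k n))"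
  unfolding escaping_def
proof (intro allI impI)
  fix C assume "compact C \<and> C \<subseteq> \<Omega>"
  then have "\<forall>\<^sub>F n in sequentially. \<sigma> n ` {0..T n} \<inter> C = {}" using assms(1) unfolding escaping_def by blast
  then show "\<forall>\<^sub>F n in sequentially. \<sigma> (k n) ` {0..T (k n)} \<inter> C = {}"
    by (rule eventually_subseq_compose[OF assms(2)])
qed

text \<open>The far point lies outside the image of a small lens, so the lift would have to travel
  from near 1 to radius \<open>rr\<close>. Escape pushes the lift so close to the unit circle that
  the exit estimate forbids this.\<close>

lemma no_escape_to_regular_point:
  assumes \<Omega>: "open \<Omega>" and c2: "condition2_at \<Omega> p" and \<Lambda>: "1 \<le> \<Lambda>"
    and ag: "\<And>n. almost_geodesic \<Omega> \<Lambda> \<kappa> {0..T n} (\<sigma> n)" and esc: "escaping \<Omega> \<sigma> T"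
    and t: "\<And>n. t n \<in> {0..T n}" and s: "\<And>n. s n \<in> {0..T n}"
    and lim: "(\<lambda>n. \<sigma> n (t n)) \<longlonglongrightarrow> p"
    and e: "0 < e" and far: "\<forall>\<^sub>F n in sequentially. e \<le> cmod (\<sigma> n (s n) - p)"
  shows False
proof -
  have in\<Omega>: "\<sigma> n (t n) \<in> \<Omega>" for n
    using ag[of n, unfolded almost_geodesic_def, THEN conjunct2, THEN conjunct1] t[of n] by blast
  obtain k :: "nat \<Rightarrow> nat" and \<phi> r where k: "strict_mono k" and chart: "boundary_chart \<Omega> \<phi> r" and \<phi>1: "\<phi> 1 = p"
    and zk: "\<And>n. \<sigma> (k n) (t (k n)) \<in> \<phi> ` ball 0 1"
    and zl: "(\<lambda>n. inv_into (ball 0 1) \<phi> (\<sigma> (k n) (t (k n)))) \<longlonglongrightarrow> 1"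
    using condition2_at_chart[OF \<Omega> c2 in\<Omega> lim] by blast
  interpret boundary_chart \<Omega> \<phi> r by (rule chart)
  obtain r1 where r1: "0 < r1" "r1 < r"
    and speed: "\<And>w v K. w \<in> ball 0 1 \<Longrightarrow> cmod (w - 1) \<le> r1 \<Longrightarrow> 1 \<le> K \<Longrightarrow> kobayashi_royden \<Omega> (\<phi> w) v \<le> K \<Longrightarrow>
       cmod (deriv g (\<phi> w) * v) \<le> 16 * K * (1 - cmod w)"
    using chart_speed_bound by metis
  have "(1::complex) \<in> cball 0 1" by simp
  then obtain d where d: "0 < d" "\<And>w. w \<in> cball 0 1 \<Longrightarrow> dist w 1 < d \<Longrightarrow> dist (\<phi> w) (\<phi> 1) < e"
    using cont e unfolding continuous_on_iff by metis
  define rr where "rr = min d r1"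
  have rr: "0 < rr" "rr \<le> r1" "rr \<le> d" using d r1 by (auto simp: rr_def)
  have lens_near: "cmod (x - p) < e" if "x \<in> \<phi> ` lens rr" for x
    using that d(2) rr \<phi>1 by (auto simp: lens_def dist_norm norm_minus_commute)
  define E where "E = 64 * \<Lambda>\<^sup>2 * sqrt (4 * exp \<kappa>)"
  have E: "E > 0" using \<Lambda> by (simp add: E_def)
  \<comment> \<open>Chosen so that the displacement bound is \<open>rr / 4\<close>. A start within
    \<open>rr / 2\<close> of 1 then gets at most three quarters of the way to the exit
    radius.\<close>
  define \<delta> where "\<delta> = (rr / (4 * E))\<^sup>2"
  have \<delta>: "0 < \<delta>" "E * sqrt \<delta> = rr / 4" using rr E by (auto simp: \<delta>_def real_sqrt_abs)
  have "compact (\<phi> ` cball 0 (1 - \<delta>))"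
  proof (intro compact_continuous_image continuous_on_subset[OF cont] compact_cball)
    show "cball 0 (1 - \<delta>) \<subseteq> (cball 0 1 :: complex set)" using \<delta> by (auto simp: subset_iff)
  qed
  moreover have "\<phi> ` cball 0 (1 - \<delta>) \<subseteq> \<Omega>"
  proof -
    have "cball 0 (1 - \<delta>) \<subseteq> (ball 0 1 :: complex set)" using \<delta> by (auto simp: subset_iff)
    then show ?thesis using into by blast
  qed
  ultimately have "\<forall>\<^sub>F n in sequentially. \<sigma> n ` {0..T n} \<inter> \<phi> ` cball 0 (1 - \<delta>) = {}"
    using esc unfolding escaping_def by blast
  then have A: "\<forall>\<^sub>F n in sequentially. \<sigma> (k n) ` {0..T (k n)} \<inter> \<phi> ` cball 0 (1 - \<delta>) = {}"
    by (rule eventually_subseq_compose[OF k])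
  have B: "\<forall>\<^sub>F n in sequentially. e \<le> cmod (\<sigma> (k n) (s (k n)) - p)"
    using far by (rule eventually_subseq_compose[OF k])
  have C: "\<forall>\<^sub>F n in sequentially. dist (g (\<sigma> (k n) (t (k n)))) 1 < rr / 2"
    using tendstoD[OF zl, of "rr / 2"] rr by simp
  obtain n where n: "\<sigma> (k n) ` {0..T (k n)} \<inter> \<phi> ` cball 0 (1 - \<delta>) = {}"
    "e \<le> cmod (\<sigma> (k n) (s (k n)) - p)" "dist (g (\<sigma> (k n) (t (k n)))) 1 < rr / 2"
    using eventually_happens'[OF _ eventually_conj[OF A eventually_conj[OF B C]]] by auto
  obtain w where w: "w \<in> ball 0 1" "\<sigma> (k n) (t (k n)) = \<phi> w" using zk[of n] by blast
  have wl: "w \<in> lens rr"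
    using n(3) w g_inverse[OF w(1)] rr by (auto simp: lens_def dist_norm norm_minus_commute)
  have "rr \<le> cmod (g (\<sigma> (k n) (t (k n))) - 1) + 64 * \<Lambda>\<^sup>2 * sqrt (4 * exp \<kappa> * \<delta>)"
  proof (rule almost_geodesic_exit[OF r1 speed ag \<Lambda> rr(1,2) t _ s])
    show "\<sigma> (k n) (t (k n)) \<in> \<phi> ` lens rr" using wl w by blast
    show "\<sigma> (k n) (s (k n)) \<notin> \<phi> ` lens rr" using lens_near n(2) by fastforce
    show "1 - cmod w' \<le> \<delta>" if "u \<in> {0..T (k n)}" "w' \<in> ball 0 1" "\<sigma> (k n) u = \<phi> w'" for u w'
    proof (rule ccontr)
      assume "\<not> 1 - cmod w' \<le> \<delta>"
      then have "w' \<in> cball 0 (1 - \<delta>)" by simp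
      then have "\<sigma> (k n) u \<in> \<sigma> (k n) ` {0..T (k n)} \<inter> \<phi> ` cball 0 (1 - \<delta>)" using that by blast
      then show False using n(1) by blast
    qed
  qed
  moreover have "64 * \<Lambda>\<^sup>2 * sqrt (4 * exp \<kappa> * \<delta>) = E * sqrt \<delta>" by (simp add: E_def real_sqrt_mult)
  ultimately have "rr \<le> cmod (g (\<sigma> (k n) (t (k n))) - 1) + rr / 4" using \<delta> by simp
  then show False using n(3) rr by (simp add: dist_norm)
qed

text \<open>A compact relatively open piece of \<open>S\<close> around \<open>z\<close> (Sura-Bura) has positive distance
  from the rest of \<open>S\<close>; \<open>U\<close> is a small metric neighbourhood of it.\<close>

lemma totally_disconnected_separation:
  fixes S :: "complex set"
  assumes S: "closed S" "totally_disconnected S" and e: "0 < e"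
  obtains U where "open U" "z \<in> U" "closure U \<subseteq> ball z e" "frontier U \<inter> S = {}"
proof (cases "z \<in> S")
  case False
  then have "open (- S)" "z \<in> - S" using S by auto
  then obtain d where d: "d > 0" "ball z d \<subseteq> - S" by (rule openE)
  define b where "b = min d e / 2"
  have b: "b > 0" "cball z b \<subseteq> ball z d" "cball z b \<subseteq> ball z e" using d e by (auto simp: b_def)
  show ?thesis
  proof (rule that[of "ball z b"])
    show "closure (ball z b) \<subseteq> ball z e" using b by simp
    show "frontier (ball z b) \<inter> S = {}" using b d by (auto simp: frontier_def)
  qed (use b in auto)
next
  case True
  have "connected_component_set S z = {z}" using S(2) True unfolding totally_disconnected_def by blast
  then have "{z} \<in> components S" using True unfolding components_def by (metis imageI)
  then obtain K where K: "openin (top_of_set S) K" "compact K" "{z} \<subseteq> K" "K \<subseteq> ball z (e/2)"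
    using Sura_Bura_clopen_subset[OF closed_imp_locally_compact[OF S(1)], of "{z}" "ball z (e/2)"] e by auto
  have KS: "K \<subseteq> S" using K(1) openin_imp_subset by blast
  obtain V where "open V" "K = S \<inter> V" using K(1) by (auto simp: openin_open)
  then have "S - K = S \<inter> - V" by auto
  then have "closed (S - K)" using S(1) \<open>open V\<close> by (metis closed_Int closed_Compl)
  then obtain d where d: "d > 0" "\<And>x y. x \<in> K \<Longrightarrow> y \<in> S - K \<Longrightarrow> d \<le> dist x y"
    using separate_compact_closed[OF K(2)] by (metis Diff_disjoint)
  \<comment> \<open>Points at distance exactly \<open>b\<close> from \<open>K\<close> avoid
    \<open>S\<close>: they are not in \<open>K\<close> as \<open>b > 0\<close>, nor in the rest of
    \<open>S\<close> as \<open>b < d\<close>. With \<open>K\<close> in the ball of radius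
    \<open>e / 2\<close>, \<open>b < e / 2\<close> keeps the neighbourhood inside
    \<open>ball z e\<close>.\<close>
  define b where "b = min d (e/2) / 2"
  have b: "0 < b" "b < d" "b < e / 2" using d e by (auto simp: b_def)
  define U where "U = {x. infdist x K < b}"
  have Kne: "K \<noteq> {}" using K by auto
  have att: "\<exists>y\<in>K. infdist x K = dist x y" for x
    using infdist_attains_inf[OF compact_imp_closed[OF K(2)] Kne] by metis
  have cl: "closure U \<subseteq> {x. infdist x K \<le> b}"
    unfolding U_def by (rule closure_minimal) (auto intro!: closed_Collect_le continuous_intros)
  show ?thesis
  proof (rule that[of U])
    show oU: "open U" unfolding U_def by (intro open_Collect_less continuous_intros)
    show "z \<in> U" using K b by (auto simp: U_def)
    show "closure U \<subseteq> ball z e"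
    proof
      fix x assume "x \<in> closure U"
      then obtain y where y: "y \<in> K" "dist x y \<le> b" using cl att[of x] by auto
      then have "dist z y < e / 2" using K by auto
      then show "x \<in> ball z e" using y b dist_triangle[of z x y] by (simp add: dist_commute)
    qed
    show "frontier U \<inter> S = {}"
    proof (rule ccontr)
      assume "frontier U \<inter> S \<noteq> {}"
      then obtain x where x: "x \<in> S" "x \<in> closure U" "x \<notin> U"
        using oU by (auto simp: frontier_def interior_open)
      then have *: "infdist x K = b" using cl by (force simp: U_def)
      then obtain y where y: "y \<in> K" "dist x y = b" using att[of x] by auto
      have "x \<notin> K" using * b by auto
      then show False using d(2)[of y x] x y b by (simp add: dist_commute)
    qed
  qed
qed

text \<open>The limit \<open>a\<close> of the points in \<open>A\<close> may belong to
  \<open>S\<close>, where no chart is available. The curves must leave a neighbourhood of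
  \<open>a\<close> whose frontier avoids \<open>S\<close>, and the crossing points accumulate at a
  boundary point that does have charts.\<close>

lemma no_escape_between:
  assumes \<Omega>: "open \<Omega>" and S: "closed S" "totally_disconnected S"
    and c2: "\<And>p. p \<in> frontier \<Omega> - S \<Longrightarrow> condition2_at \<Omega> p" and \<Lambda>: "1 \<le> \<Lambda>"
    and ag: "\<And>n. almost_geodesic \<Omega> \<Lambda> \<kappa> {0..T n} (\<sigma> n)" and esc: "escaping \<Omega> \<sigma> T"
    and t: "\<And>n. t n \<in> {0..T n}" and s: "\<And>n. s n \<in> {0..T n}"
    and A: "compact A" "\<And>n. \<sigma> n (t n) \<in> A"
    and e: "0 < e" and far: "\<And>n a. a \<in> A \<Longrightarrow> e \<le> dist a (\<sigma> n (s n))"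
  shows False
proof -
  have \<sigma>\<Omega>: "\<sigma> n ` {0..T n} \<subseteq> \<Omega>" for n
    using ag[of n, unfolded almost_geodesic_def, THEN conjunct2, THEN conjunct1] .
  have c\<sigma>: "continuous_on {0..T n} (\<sigma> n)" for n
    using ag[of n, unfolded almost_geodesic_def] is_interval_cc
    by (intro absolutely_continuous_on_imp_continuous_on) auto
  obtain a k1 where a: "a \<in> A" "strict_mono (k1 :: nat \<Rightarrow> nat)" "((\<lambda>n. \<sigma> n (t n)) \<circ> k1) \<longlonglongrightarrow> a"
    using A unfolding compact_def by metis
  obtain U where U: "open U" "a \<in> U" "closure U \<subseteq> ball a e" "frontier U \<inter> S = {}"
    using totally_disconnected_separation[OF S e] by blast
  have "\<forall>\<^sub>F n in sequentially. \<sigma> (k1 n) (t (k1 n)) \<in> U"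
    using topological_tendstoD[OF a(3) U(1,2)] by simp
  then obtain N where N: "\<And>n. n \<ge> N \<Longrightarrow> \<sigma> (k1 n) (t (k1 n)) \<in> U"
    unfolding eventually_sequentially by blast
  define k2 where "k2 n = k1 (n + N)" for n
  have k2: "strict_mono k2" using a(2) by (auto simp: k2_def strict_mono_def)
  have inU: "\<sigma> (k2 n) (t (k2 n)) \<in> U" for n using N by (simp add: k2_def)
  have lim2: "(\<lambda>n. \<sigma> (k2 n) (t (k2 n))) \<longlonglongrightarrow> a"
    using LIMSEQ_ignore_initial_segment[OF a(3), of N] by (simp add: k2_def)
  \<comment> \<open>At time \<open>t\<close> the curve is in \<open>U\<close>; at time
    \<open>s\<close> it is at distance at least \<open>e\<close> from \<open>a\<close>, hence
    outside the closure of \<open>U\<close>.\<close>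
  have "\<exists>c\<in>{0..T (k2 n)}. \<sigma> (k2 n) c \<in> frontier U" for n
  proof -
    let ?I = "{0..T (k2 n)}"
    have "connected (\<sigma> (k2 n) ` ?I)" using c\<sigma> by (intro connected_continuous_image) auto
    moreover have "\<sigma> (k2 n) ` ?I \<inter> U \<noteq> {}" using inU[of n] t[of "k2 n"] by blast
    moreover have "\<sigma> (k2 n) (s (k2 n)) \<notin> U"
      using far[OF a(1), of "k2 n"] U(3) closure_subset[of U] by fastforce
    then have "\<sigma> (k2 n) ` ?I - U \<noteq> {}" using s[of "k2 n"] by blast
    ultimately show ?thesis using connected_Int_frontier by blast
  qed
  then obtain c where c: "\<And>n. c n \<in> {0..T (k2 n)}" "\<And>n. \<sigma> (k2 n) (c n) \<in> frontier U" by metis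
  have "bounded U" using U(3) bounded_subset[OF bounded_ball] closure_subset by blast
  then have "compact (frontier U)" by (rule compact_frontier_bounded)
  then obtain p k3 where p: "p \<in> frontier U" "strict_mono (k3 :: nat \<Rightarrow> nat)" "((\<lambda>n. \<sigma> (k2 n) (c n)) \<circ> k3) \<longlonglongrightarrow> p"
    using c(2) unfolding compact_def by metis
  define k where "k n = k2 (k3 n)" for n
  have k: "strict_mono k" using k2 p(2) by (auto simp: k_def strict_mono_def)
  have cT: "c (k3 n) \<in> {0..T (k n)}" for n using c(1) by (simp add: k_def)
  have limp: "(\<lambda>n. \<sigma> (k n) (c (k3 n))) \<longlonglongrightarrow> p" using p(3) by (simp add: k_def o_def)
  have esck: "escaping \<Omega> (\<lambda>n. \<sigma> (k n)) (\<lambda>n. T (k n))" using escaping_subseq[OF esc k] .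
  \<comment> \<open>A limit point inside the domain would have a compact disc around it, which the
    escaping curves eventually miss.\<close>
  have "p \<notin> \<Omega>"
  proof
    assume "p \<in> \<Omega>"
    then obtain d where d: "d > 0" "cball p d \<subseteq> \<Omega>" using \<Omega> open_contains_cball by blast
    have E1: "\<forall>\<^sub>F n in sequentially. \<sigma> (k n) ` {0..T (k n)} \<inter> cball p d = {}"
      using esck d(2) unfolding escaping_def by simp
    have E2: "\<forall>\<^sub>F n in sequentially. dist (\<sigma> (k n) (c (k3 n))) p < d" using tendstoD[OF limp d(1)] .
    obtain n where n: "\<sigma> (k n) ` {0..T (k n)} \<inter> cball p d = {}" "dist (\<sigma> (k n) (c (k3 n))) p < d"
      using eventually_happens'[OF _ eventually_conj[OF E1 E2]] by auto
    have "\<sigma> (k n) (c (k3 n)) \<in> \<sigma> (k n) ` {0..T (k n)} \<inter> cball p d"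
      using n(2) cT by (simp add: dist_commute)
    then show False using n(1) by blast
  qed
  moreover have "p \<in> closure \<Omega>"
    unfolding closure_sequential using limp \<sigma>\<Omega> cT by (intro exI[of _ "\<lambda>n. \<sigma> (k n) (c (k3 n))"]) blast
  ultimately have "p \<in> frontier \<Omega> - S" using U(4) p(1) \<Omega> by (auto simp: frontier_def interior_open)
  then have c2p: "condition2_at \<Omega> p" by (rule c2)
  \<comment> \<open>\<open>a\<close> lies in the open set \<open>U\<close> and \<open>p\<close> on
    its frontier, so they differ; half their distance survives the passage to the limit.\<close>
  have pa: "0 < dist a p / 2" using p(1) U by (auto simp: frontier_def interior_open)
  have lima: "(\<lambda>n. \<sigma> (k n) (t (k n))) \<longlonglongrightarrow> a"
    using LIMSEQ_subseq_LIMSEQ[OF lim2 p(2)] by (simp add: k_def o_def)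
  have "\<forall>\<^sub>F n in sequentially. dist a p / 2 \<le> cmod (\<sigma> (k n) (t (k n)) - p)"
    using tendstoD[OF lima pa]
  proof eventually_elim
    case (elim n)
    then show ?case
      using dist_triangle[of a p "\<sigma> (k n) (t (k n))"] by (simp add: dist_norm norm_minus_commute)
  qed
  \<comment> \<open>The crossing times now act as starting times, and the original times
    \<open>t\<close> provide the far points.\<close>
  then show False
    using no_escape_to_regular_point[OF \<Omega> c2p \<Lambda> ag esck cT t limp pa] by blast
qed

section \<open>Local connectedness of the closure\<close>

text \<open>The image of a small lens together with the point 1 is a connected piece of the closure
  inside \<open>Q\<close>. It contains \<open>p\<close>, and some \<open>x n\<close> as well,
  because the preimages converge to 1.\<close>

lemma condition2_at_local_connected:
  assumes \<Omega>: "open \<Omega>" and c2: "condition2_at \<Omega> p" and Q: "open Q" "p \<in> Q" and p: "p \<in> closure \<Omega>"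
    and x: "\<And>n. x n \<in> \<Omega>" "x \<longlonglongrightarrow> p"
  shows "\<exists>n. connected_component (closure \<Omega> \<inter> Q) p (x n)"
proof -
  obtain k :: "nat \<Rightarrow> nat" and \<phi> r where chart: "boundary_chart \<Omega> \<phi> r" and \<phi>1: "\<phi> 1 = p"
    and zk: "\<And>n. x (k n) \<in> \<phi> ` ball 0 1"
    and zl: "(\<lambda>n. inv_into (ball 0 1) \<phi> (x (k n))) \<longlonglongrightarrow> 1"
    using condition2_at_chart[OF \<Omega> c2 x] by blast
  interpret boundary_chart \<Omega> \<phi> r by (rule chart)
  obtain e where e: "0 < e" "ball p e \<subseteq> Q" using Q by (rule openE)
  have "(1::complex) \<in> cball 0 1" by simp
  then obtain d where d: "0 < d" "\<And>w. w \<in> cball 0 1 \<Longrightarrow> dist w 1 < d \<Longrightarrow> dist (\<phi> w) (\<phi> 1) < e"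
    using cont e unfolding continuous_on_iff by metis
  let ?L = "cball 0 1 \<inter> ball 1 d"
  let ?M = "insert 1 (lens d)"
  have lensL: "?M \<subseteq> ?L" using d by (auto simp: lens_def)
  \<comment> \<open>The lens is convex, and 1 lies in its closure.\<close>
  have "connected ?M"
  proof (rule connected_intermediate_closure[of "lens d"])
    show "connected (lens d)" unfolding lens_def by (intro convex_connected convex_Int convex_ball)
    have "(1::complex) \<in> closure (ball 0 1 \<inter> ball 1 d)"
    proof -
      have "ball 1 d \<inter> closure (ball 0 1) \<subseteq> closure (ball 1 d \<inter> (ball 0 1 :: complex set))"
        by (rule open_Int_closure_subset) simp
      then show ?thesis using d by (auto simp: Int_commute)
    qed
    then show "?M \<subseteq> closure (lens d)" using closure_subset[of "lens d"] unfolding lens_def by simp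
  qed blast
  then have "connected (\<phi> ` ?M)"
    using continuous_on_subset[OF cont] lensL by (intro connected_continuous_image) auto
  moreover have "\<phi> ` ?M \<subseteq> closure \<Omega> \<inter> Q"
  proof
    fix y assume "y \<in> \<phi> ` ?M"
    then obtain w where w: "y = \<phi> w" "w \<in> ?M" by blast
    have "y \<in> ball p e" using d(2)[of w] subsetD[OF lensL w(2)] w(1) \<phi>1 by (auto simp: dist_commute)
    moreover have "y \<in> closure \<Omega>"
      using w p \<phi>1 into closure_subset[of \<Omega>] by (fastforce simp: lens_def)
    ultimately show "y \<in> closure \<Omega> \<inter> Q" using e by blast
  qed
  moreover have "p \<in> \<phi> ` ?M" using \<phi>1 by blast
  ultimately have sub: "\<phi> ` ?M \<subseteq> connected_component_set (closure \<Omega> \<inter> Q) p"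
    by (intro connected_component_maximal)
  obtain n where n: "dist (g (x (k n))) 1 < d"
    using eventually_happens'[OF _ tendstoD[OF zl d(1)]] by auto
  obtain w where w: "w \<in> ball 0 1" "x (k n) = \<phi> w" using zk[of n] by blast
  have "w \<in> ?M" using n w g_inverse[OF w(1)] by (auto simp: lens_def dist_commute)
  then have "x (k n) \<in> connected_component_set (closure \<Omega> \<inter> Q) p" using sub w(2) by blast
  then show ?thesis by auto
qed

lemma nhd_in_connected_component_if_seq:
  fixes X :: "'a::metric_space set"
  assumes "\<And>x. (\<And>n. x n \<in> X) \<Longrightarrow> x \<longlonglongrightarrow> z \<Longrightarrow> \<exists>n::nat. P (x n)"
  obtains d where "0 < d" "\<And>x. x \<in> X \<Longrightarrow> dist x z < d \<Longrightarrow> P x"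
proof (rule ccontr)
  assume "\<not> thesis"
  then have "\<exists>x\<in>X. dist x z < 1 / real (Suc n) \<and> \<not> P x" for n
    using that[of "1 / real (Suc n)"] by force
  then obtain x where x: "\<And>n. x n \<in> X" "\<And>n. dist (x n) z < 1 / real (Suc n)" "\<And>n. \<not> P (x n)" by metis
  have "x \<longlonglongrightarrow> z"
  proof (rule tendsto_dist_iff[THEN iffD2, OF Lim_null_comparison])
    show "\<forall>\<^sub>F n in sequentially. norm (dist (x n) z) \<le> 1 / real (Suc n)" using less_imp_le[OF x(2)] by simp
    show "(\<lambda>n. 1 / real (Suc n)) \<longlonglongrightarrow> 0" by (rule LIMSEQ_Suc[OF lim_1_over_n])
  qed
  then show False using assms[of x] x by blast
qed

text \<open>Boundary bumping. The component of \<open>x\<close> in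
  \<open>\<Omega> \<inter> U\<close> is open but cannot be closed in the connected set
  \<open>\<Omega>\<close>; a limit point of it in \<open>\<Omega>\<close> outside it cannot lie in
  \<open>U\<close>, since it could then be added to the component.\<close>

lemma connected_component_reaches_frontier:
  fixes \<Omega> U :: "'a::real_normed_vector set"
  assumes "open \<Omega>" "connected \<Omega>" "open U" "x \<in> \<Omega>" "x \<in> U" "\<not> \<Omega> \<subseteq> U"
  obtains y D where "connected D" "x \<in> D" "y \<in> D" "D \<subseteq> \<Omega>" "D \<subseteq> closure U" "y \<in> frontier U"
proof -
  let ?A = "connected_component_set (\<Omega> \<inter> U) x"
  have xA: "x \<in> ?A" using assms by simp
  have Asub: "?A \<subseteq> \<Omega> \<inter> U" by (rule connected_component_subset)
  have "open ?A" using assms by (intro open_connected_component open_Int)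
  then have oA: "openin (top_of_set \<Omega>) ?A" using Asub by (simp add: open_openin_trans assms(1))
  have "\<not> closedin (top_of_set \<Omega>) ?A"
  proof
    assume "closedin (top_of_set \<Omega>) ?A"
    then have "?A = \<Omega>" using oA assms(2) xA unfolding connected_clopen by blast
    then show False using Asub assms(6) by blast
  qed
  then have "\<Omega> \<inter> closure ?A \<noteq> ?A"
    by (metis closed_closure closedin_closed_Int)
  moreover have "?A \<subseteq> \<Omega> \<inter> closure ?A" using Asub closure_subset by blast
  ultimately obtain y where y: "y \<in> \<Omega>" "y \<in> closure ?A" "y \<notin> ?A" by blast
  have conn: "connected (insert y ?A)"
    using y(2) closure_subset[of ?A]
    by (intro connected_intermediate_closure[OF connected_connected_component]) blast+
  have "y \<notin> U"
  proof
    assume "y \<in> U"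
    then have "insert y ?A \<subseteq> \<Omega> \<inter> U" using y Asub by blast
    then have "insert y ?A \<subseteq> ?A" using conn xA by (intro connected_component_maximal) auto
    then show False using y(3) by blast
  qed
  moreover have clU: "closure ?A \<subseteq> closure U" using Asub by (intro closure_mono) blast
  ultimately have "y \<in> frontier U" using y(2) assms(3) by (auto simp: frontier_def interior_open)
  moreover have "insert y ?A \<subseteq> closure U" using y(2) clU closure_subset[of ?A] by blast
  moreover have "insert y ?A \<subseteq> \<Omega>" using y(1) Asub by blast
  ultimately show ?thesis using that[of "insert y ?A" y] conn xA by blast
qed

text \<open>Near a point of \<open>S\<close> the charts are replaced by a detour: nearby points of
  the domain are joined, within a small neighbourhood, to its frontier off \<open>S\<close>, and a
  limit point there links them to \<open>z\<close>.\<close>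

lemma closure_domain_locally_connected:
  assumes \<Omega>: "open \<Omega>" "connected \<Omega>" and S: "closed S" "totally_disconnected S"
    and c2: "\<And>p. p \<in> frontier \<Omega> - S \<Longrightarrow> condition2_at \<Omega> p"
    and Q: "open Q" "z \<in> Q" and z: "z \<in> closure \<Omega>"
  obtains d where "0 < d" "closure \<Omega> \<inter> ball z d \<subseteq> connected_component_set (closure \<Omega> \<inter> Q) z"
proof -
  let ?cc = "connected_component (closure \<Omega> \<inter> Q)"
  have regular: "\<exists>d>0. \<forall>x\<in>\<Omega>. dist x p < d \<longrightarrow> ?cc p x" if p: "p \<in> closure \<Omega> - S" "p \<in> Q" for p
  proof (cases "p \<in> \<Omega>")
    case True
    then obtain d where d: "d > 0" "ball p d \<subseteq> \<Omega> \<inter> Q"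
      using \<Omega> Q p open_Int openE by (metis IntI)
    have "ball p d \<subseteq> connected_component_set (closure \<Omega> \<inter> Q) p"
      using d closure_subset[of \<Omega>] by (intro connected_component_maximal) auto
    then have "?cc p x" if "dist x p < d" for x using that by (simp add: subset_iff dist_commute)
    then show ?thesis using d by blast
  next
    case False
    then have "p \<in> frontier \<Omega> - S" using p \<Omega> by (simp add: frontier_def interior_open)
    then have c2p: "condition2_at \<Omega> p" by (rule c2)
    have seq: "\<exists>n. ?cc p (x n)" if "\<And>n. x n \<in> \<Omega>" "x \<longlonglongrightarrow> p" for x
      using condition2_at_local_connected[OF \<Omega>(1) c2p Q(1) p(2) _ that] p(1) by blast
    obtain d where "0 < d" "\<And>x. x \<in> \<Omega> \<Longrightarrow> dist x p < d \<Longrightarrow> ?cc p x"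
      using nhd_in_connected_component_if_seq[of \<Omega> p "?cc p", OF seq] by metis
    then show ?thesis by blast
  qed
  have closedcc: "closedin (top_of_set (closure \<Omega> \<inter> Q)) (connected_component_set (closure \<Omega> \<inter> Q) p)" for p
    by (rule closedin_connected_component)
  \<comment> \<open>Components are relatively closed, so membership passes to limits that stay in
    \<open>closure \<Omega> \<inter> Q\<close>.\<close>
  have cc_lim: "l \<in> connected_component_set (closure \<Omega> \<inter> Q) p"
    if "\<forall>\<^sub>F n in sequentially. x n \<in> connected_component_set (closure \<Omega> \<inter> Q) p" "x \<longlonglongrightarrow> l" "l \<in> closure \<Omega> \<inter> Q"
    for x :: "nat \<Rightarrow> complex" and l p
  proof -
    obtain T where T: "closed T" "connected_component_set (closure \<Omega> \<inter> Q) p = (closure \<Omega> \<inter> Q) \<inter> T"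
      using closedcc[of p] unfolding closedin_closed by blast
    have "\<forall>\<^sub>F n in sequentially. x n \<in> T" using that(1) unfolding T(2) by (auto elim: eventually_mono)
    then have "l \<in> T" using T(1) that(2) Lim_in_closed_set[of T x] by simp
    then show ?thesis unfolding T(2) using that(3) by blast
  qed
  have seq: "\<exists>n. ?cc z (x n)" if x: "\<And>n. x n \<in> \<Omega>" "x \<longlonglongrightarrow> z" for x
  proof -
    obtain e where e: "0 < e" "ball z e \<subseteq> Q" using Q by (rule openE)
    obtain U where U: "open U" "z \<in> U" "closure U \<subseteq> ball z e" "frontier U \<inter> S = {}"
      using totally_disconnected_separation[OF S e(1)] by blast
    have UO: "closure U \<subseteq> Q" using U e by blast
    show ?thesis
    proof (cases "\<Omega> \<subseteq> U")
      \<comment> \<open>No frontier can be reached here, but the whole connected domain lies in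
        \<open>Q\<close>.\<close>
      case True
      have OmO: "\<Omega> \<subseteq> Q" using True UO closure_subset by blast
      have "connected (insert z \<Omega>)"
        using z closure_subset[of \<Omega>] by (intro connected_intermediate_closure[OF \<Omega>(2)]) blast+
      then have "insert z \<Omega> \<subseteq> connected_component_set (closure \<Omega> \<inter> Q) z"
        using OmO z Q closure_subset[of \<Omega>] by (intro connected_component_maximal) auto
      then show ?thesis using x(1)[of 0] by auto
    next
      case False
      have "\<forall>\<^sub>F n in sequentially. x n \<in> U" using topological_tendstoD[OF x(2) U(1,2)] .
      then obtain N where N: "\<And>n. n \<ge> N \<Longrightarrow> x n \<in> U" unfolding eventually_sequentially by blast
      define x' where "x' = (\<lambda>n. x (n + N))"
      have x': "\<And>n. x' n \<in> \<Omega>" "\<And>n. x' n \<in> U" "x' \<longlonglongrightarrow> z"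
        using x N LIMSEQ_ignore_initial_segment[OF x(2), of N] by (auto simp: x'_def)
      have "\<exists>y. y \<in> frontier U \<and> y \<in> \<Omega> \<and> ?cc y (x' n)" for n
      proof -
        obtain y D where D: "connected D" "x' n \<in> D" "y \<in> D" "D \<subseteq> \<Omega>" "D \<subseteq> closure U" "y \<in> frontier U"
          using connected_component_reaches_frontier[OF \<Omega> U(1) x'(1,2) False] by metis
        have "D \<subseteq> closure \<Omega> \<inter> Q" using D(4,5) UO closure_subset by blast
        then have "D \<subseteq> connected_component_set (closure \<Omega> \<inter> Q) y"
          using D by (intro connected_component_maximal)
        then show ?thesis using D by blast
      qed
      then obtain y where y: "\<And>n. y n \<in> frontier U" "\<And>n. y n \<in> \<Omega>" "\<And>n. ?cc (y n) (x' n)" by metis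
      have "bounded U" using U(3) bounded_subset[OF bounded_ball] closure_subset by blast
      then have "compact (frontier U)" by (rule compact_frontier_bounded)
      then obtain p k where p: "p \<in> frontier U" "strict_mono (k :: nat \<Rightarrow> nat)" "(y \<circ> k) \<longlonglongrightarrow> p"
        using y(1) unfolding compact_def by metis
      have "p \<in> closure \<Omega>" unfolding closure_sequential using p(3) y(2) by (intro exI[of _ "y \<circ> k"]) auto
      moreover have "p \<notin> S" using p(1) U(4) by blast
      moreover have "p \<in> Q" using p(1) UO by (auto simp: frontier_def)
      ultimately obtain d where d: "d > 0" "\<And>x. x \<in> \<Omega> \<Longrightarrow> dist x p < d \<Longrightarrow> ?cc p x"
        using regular[of p] by auto
      have ev: "\<forall>\<^sub>F n in sequentially. (x' \<circ> k) n \<in> connected_component_set (closure \<Omega> \<inter> Q) p"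
        using tendstoD[OF p(3) d(1)]
      proof eventually_elim
        case (elim n)
        then have "?cc p (y (k n))" using d(2) y(2) by simp
        then show ?case using y(3)[of "k n"] connected_component_trans by auto
      qed
      \<comment> \<open>The points \<open>x' (k n)\<close> eventually lie in the component of
        \<open>p\<close> and converge to \<open>z\<close>, so \<open>z\<close> lies in it too and
        \<open>p\<close> links \<open>z\<close> to them.\<close>
      have "z \<in> connected_component_set (closure \<Omega> \<inter> Q) p"
        by (rule cc_lim[OF ev LIMSEQ_subseq_LIMSEQ[OF x'(3) p(2)]]) (use z Q in auto)
      then have zp: "?cc z p" by (simp add: connected_component_sym)
      obtain n where "(x' \<circ> k) n \<in> connected_component_set (closure \<Omega> \<inter> Q) p"
        using eventually_happens'[OF _ ev] by auto
      then have "?cc z (x' (k n))" using connected_component_trans[OF zp] by simp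
      then show ?thesis unfolding x'_def by blast
    qed
  qed
  obtain d where d: "0 < d" "\<And>x. x \<in> \<Omega> \<Longrightarrow> dist x z < d \<Longrightarrow> ?cc z x"
    using nhd_in_connected_component_if_seq[of \<Omega> z "?cc z", OF seq] by metis
  obtain e where e: "0 < e" "ball z e \<subseteq> Q" using Q by (rule openE)
  \<comment> \<open>So far only points of \<open>\<Omega>\<close> near \<open>z\<close> are covered;
    boundary points follow by approximation, the bound \<open>e\<close> on the radius keeping them
    in \<open>Q\<close>.\<close>
  have "closure \<Omega> \<inter> ball z (min d e) \<subseteq> connected_component_set (closure \<Omega> \<inter> Q) z"
  proof
    fix x assume x: "x \<in> closure \<Omega> \<inter> ball z (min d e)"
    then obtain s where s: "\<And>n. s n \<in> \<Omega>" "s \<longlonglongrightarrow> x" using closure_sequential[of x \<Omega>] by blast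
    have "\<forall>\<^sub>F n in sequentially. s n \<in> ball z d"
      by (rule topological_tendstoD[OF s(2)]) (use x in auto)
    then have ev: "\<forall>\<^sub>F n in sequentially. s n \<in> connected_component_set (closure \<Omega> \<inter> Q) z"
      by (rule eventually_mono) (use d(2) s(1) in \<open>auto simp: dist_commute\<close>)
    have "x \<in> Q" using e x by auto
    then show "x \<in> connected_component_set (closure \<Omega> \<inter> Q) z"
      using cc_lim[OF ev s(2)] x by blast
  qed
  then show ?thesis using that[of "min d e"] d e by simp
qed

text \<open>This makes the sets \<open>end_nhd\<close> open, hence genuine neighbourhoods of the
  ends.\<close>

lemma components_closure_diff_openin:
  assumes \<Omega>: "open \<Omega>" "connected \<Omega>" and S: "closed S" "totally_disconnected S"
    and c2: "\<And>p. p \<in> frontier \<Omega> - S \<Longrightarrow> condition2_at \<Omega> p"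
    and K: "compact K" and C: "C \<in> components (closure \<Omega> - K)"
  shows "openin (top_of_set (closure \<Omega>)) C"
proof -
  have Q: "open (- K)" using K by (simp add: compact_imp_closed open_Compl)
  show ?thesis
    unfolding openin_contains_ball
  proof (intro conjI ballI)
    show "C \<subseteq> closure \<Omega>" using in_components_subset[OF C] by blast
    fix z assume z: "z \<in> C"
    then have zK: "z \<in> closure \<Omega>" "z \<in> - K" using in_components_subset[OF C] by auto
    obtain d where d: "0 < d" "closure \<Omega> \<inter> ball z d \<subseteq> connected_component_set (closure \<Omega> \<inter> - K) z"
      using closure_domain_locally_connected[OF \<Omega> S c2 Q zK(2,1)] by blast
    have "C = connected_component_set (closure \<Omega> - K) z"
      using C z by (metis components_iff connected_component_eq)
    then show "\<exists>e>0. ball z e \<inter> closure \<Omega> \<subseteq> C"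
      using d by (intro exI[of _ d]) (auto simp: Diff_eq Int_commute)
  qed
qed

section \<open>The end compactification\<close>

lemma compact_exhaustion_mono:
  assumes "compact_exhaustion X K" "i \<le> j"
  shows "K i \<subseteq> K j"
proof -
  have "K n \<subseteq> K (Suc n)" for n
    using assms(1) interior_of_subset[of "top_of_set X" "K (Suc n)"] unfolding compact_exhaustion_def by blast
  then show ?thesis using assms(2) by (rule lift_Suc_mono_le)
qed

lemma compact_exhaustion_nhd:
  assumes "compact_exhaustion X K"
  obtains W where "open W" "K j \<subseteq> W" "X \<inter> W \<subseteq> K (Suc j)"
proof -
  have "openin (top_of_set X) (top_of_set X interior_of K (Suc j))" by simp
  then obtain W where W: "open W" "top_of_set X interior_of K (Suc j) = X \<inter> W"
    unfolding openin_open by blast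
  moreover have "K j \<subseteq> top_of_set X interior_of K (Suc j)"
    using assms unfolding compact_exhaustion_def by blast
  ultimately show ?thesis using that[of W] interior_of_subset[of "top_of_set X" "K (Suc j)"] by blast
qed

lemma compact_exhaustion_absorbs:
  fixes X C :: "'a::metric_space set"
  assumes K: "compact_exhaustion X K" and C: "compact C" "C \<subseteq> X"
  obtains j where "C \<subseteq> K j"
proof -
  have "\<forall>j. \<exists>W. open W \<and> K j \<subseteq> W \<and> X \<inter> W \<subseteq> K (Suc j)"
    using compact_exhaustion_nhd[OF K] by metis
  then obtain W where W: "\<And>j. open (W j)" "\<And>j. K j \<subseteq> W j" "\<And>j. X \<inter> W j \<subseteq> K (Suc j)" by metis
  have "C \<subseteq> (\<Union>j. W j)" using C(2) K W(2) unfolding compact_exhaustion_def by blast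
  then obtain J where J: "finite J" "C \<subseteq> (\<Union>j\<in>J. W j)"
    using compactE_image[OF C(1), of UNIV W] W(1) by (metis UNIV_I)
  \<comment> \<open>Inserting 0 gives the maximum a meaning when \<open>J\<close> is empty; the
    successor comes from the passage from \<open>W j\<close> to \<open>K (Suc j)\<close>.\<close>
  have "C \<subseteq> K (Suc (Max (insert 0 J)))"
  proof
    fix x assume x: "x \<in> C"
    then obtain j where j: "j \<in> J" "x \<in> W j" using J by blast
    then have "Suc j \<le> Suc (Max (insert 0 J))" using J(1) by simp
    then show "x \<in> K (Suc (Max (insert 0 J)))"
      using compact_exhaustion_mono[OF K] W(3)[of j] x C(2) j by blast
  qed
  then show ?thesis using that by blast
qed

section \<open>Open sets of the end compactification\<close>

lemma end_open_Pt_image: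
  assumes "openin (top_of_set (closure \<Omega>)) A"
  shows "openin (end_topology \<Omega> K) (Pt ` A)"
proof -
  have A: "A \<subseteq> closure \<Omega>" "\<And>z. z \<in> A \<Longrightarrow> \<exists>e>0. ball z e \<inter> closure \<Omega> \<subseteq> A"
    using assms unfolding openin_contains_ball by auto
  show ?thesis
    unfolding openin_end_topology end_open_def
  proof (intro conjI allI impI)
    show "Pt ` A \<subseteq> end_carrier \<Omega> K" using A(1) by (auto simp: end_carrier_def)
    fix z assume "Pt z \<in> Pt ` A"
    then obtain e where "e > 0" "ball z e \<inter> closure \<Omega> \<subseteq> A" using A(2) by blast
    then show "\<exists>e>0. Pt ` (closure \<Omega> \<inter> ball z e) \<subseteq> Pt ` A" by blast
  qed auto
qed

lemma end_in_components: "F \<in> ends \<Omega> K \<Longrightarrow> F j \<in> components (closure \<Omega> - K j)"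
  by (auto simp: ends_def split: if_splits)

lemma end_nhd_subset_carrier: "F \<in> ends \<Omega> K \<Longrightarrow> end_nhd \<Omega> K F j \<subseteq> end_carrier \<Omega> K"
  using in_components_subset[OF end_in_components] by (fastforce simp: end_nhd_def end_carrier_def)

text \<open>A compact set is absorbed by some \<open>K j\<close>, so it is missed by the
  \<open>j\<close>-th component of every end.\<close>

lemma end_open_compact_complement:
  assumes K: "compact_exhaustion (closure \<Omega>) K" and C: "compact C" "C \<subseteq> closure \<Omega>"
  shows "openin (end_topology \<Omega> K) (end_carrier \<Omega> K - Pt ` C)"
  unfolding openin_end_topology end_open_def
proof (intro conjI allI impI)
  fix z assume "Pt z \<in> end_carrier \<Omega> K - Pt ` C"
  then have "z \<in> - C" by blast
  moreover have "open (- C)" using C by (simp add: compact_imp_closed open_Compl)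
  ultimately obtain e where "e > 0" "ball z e \<subseteq> - C" using openE by blast
  then show "\<exists>e>0. Pt ` (closure \<Omega> \<inter> ball z e) \<subseteq> end_carrier \<Omega> K - Pt ` C"
    by (intro exI[of _ e]) (auto simp: end_carrier_def)
next
  fix F assume "End F \<in> end_carrier \<Omega> K - Pt ` C"
  then have F: "F \<in> ends \<Omega> K" by (auto simp: end_carrier_def)
  obtain j where j: "C \<subseteq> K j" using compact_exhaustion_absorbs[OF K C] by blast
  have "F j \<inter> C = {}" using in_components_subset[OF end_in_components[OF F]] j by blast
  then have "end_nhd \<Omega> K F j \<subseteq> end_carrier \<Omega> K - Pt ` C"
    using end_nhd_subset_carrier[OF F, of j] by (auto simp: end_nhd_def)
  then show "\<exists>j. end_nhd \<Omega> K F j \<subseteq> end_carrier \<Omega> K - Pt ` C" by blast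
qed blast

lemma end_open_end_nhd:
  assumes F: "F \<in> ends \<Omega> K" and o: "openin (top_of_set (closure \<Omega>)) (F j)"
  shows "openin (end_topology \<Omega> K) (end_nhd \<Omega> K F j)"
  unfolding openin_end_topology end_open_def
proof (intro conjI allI impI end_nhd_subset_carrier[OF F])
  fix z assume "Pt z \<in> end_nhd \<Omega> K F j"
  then have "z \<in> F j" by (auto simp: end_nhd_def)
  then obtain e where "e > 0" "ball z e \<inter> closure \<Omega> \<subseteq> F j"
    using o unfolding openin_contains_ball by blast
  then show "\<exists>e>0. Pt ` (closure \<Omega> \<inter> ball z e) \<subseteq> end_nhd \<Omega> K F j"
    by (intro exI[of _ e]) (auto simp: end_nhd_def)
next
  fix G assume "End G \<in> end_nhd \<Omega> K F j"
  then have G: "G \<in> ends \<Omega> K" "\<And>\<nu>. \<nu> \<le> j \<Longrightarrow> G \<nu> = F \<nu>" by (auto simp: end_nhd_def)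
  then have "end_nhd \<Omega> K G j \<subseteq> end_nhd \<Omega> K F j" by (auto simp: end_nhd_def)
  then show "\<exists>i. end_nhd \<Omega> K G i \<subseteq> end_nhd \<Omega> K F j" by blast
qed

text \<open>All constants are quantified inside, so one pair of neighbourhoods serves every
  \<open>\<Lambda>\<close> and \<open>\<kappa>\<close>. Arbitrary times instead of the endpoints
  make the notion symmetric without reversing curves.\<close>

definition never_joined :: "complex set \<Rightarrow> end_point set \<Rightarrow> end_point set \<Rightarrow> bool" where
  "never_joined \<Omega> V W \<longleftrightarrow>
     (\<forall>\<Lambda> \<kappa> \<sigma> T t s. 1 \<le> \<Lambda> \<longrightarrow> (\<forall>n. almost_geodesic \<Omega> \<Lambda> \<kappa> {0..T n} (\<sigma> n)) \<longrightarrow> escaping \<Omega> \<sigma> T \<longrightarrow>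
        (\<forall>n. t n \<in> {0..T n}) \<longrightarrow> (\<forall>n. s n \<in> {0..T n}) \<longrightarrow>
        (\<forall>n. Pt (\<sigma> n (t n)) \<in> V) \<longrightarrow> (\<forall>n. Pt (\<sigma> n (s n)) \<in> W) \<longrightarrow> False)"

lemma never_joined_sym: "never_joined \<Omega> V W \<Longrightarrow> never_joined \<Omega> W V"
  unfolding never_joined_def by metis

definition seq_visible :: "complex set \<Rightarrow> (nat \<Rightarrow> complex set) \<Rightarrow> end_point \<Rightarrow> end_point \<Rightarrow> bool" where
  "seq_visible \<Omega> K \<zeta> \<eta> \<longleftrightarrow>
     (\<exists>V W. V \<subseteq> end_carrier \<Omega> K \<and> W \<subseteq> end_carrier \<Omega> K \<and>
        \<zeta> \<in> end_topology \<Omega> K interior_of V \<and> \<eta> \<in> end_topology \<Omega> K interior_of W \<and>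
        end_topology \<Omega> K closure_of V \<inter> end_topology \<Omega> K closure_of W = {} \<and> never_joined \<Omega> V W)"

lemma seq_visible_sym: "seq_visible \<Omega> K \<zeta> \<eta> \<Longrightarrow> seq_visible \<Omega> K \<eta> \<zeta>"
  unfolding seq_visible_def using never_joined_sym by (metis Int_commute)

text \<open>If no compact set of an exhaustion of \<open>\<Omega>\<close> is a witness, the
  \<open>n\<close>-th one is missed by some curve \<open>\<sigma> n\<close>; since the exhaustion
  absorbs every compact set, these curves escape.\<close>

lemma seq_visible_imp_visible_pair:
  assumes \<Omega>: "open \<Omega>" and vis: "seq_visible \<Omega> K \<zeta> \<eta>" and \<Lambda>: "1 \<le> \<Lambda>"
  shows "visible_pair \<Omega> K \<Lambda> \<kappa> \<zeta> \<eta>"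
proof (rule ccontr)
  assume nvis: "\<not> visible_pair \<Omega> K \<Lambda> \<kappa> \<zeta> \<eta>"
  obtain V W where *: "V \<subseteq> end_carrier \<Omega> K" "W \<subseteq> end_carrier \<Omega> K"
        "\<zeta> \<in> end_topology \<Omega> K interior_of V" "\<eta> \<in> end_topology \<Omega> K interior_of W"
        "end_topology \<Omega> K closure_of V \<inter> end_topology \<Omega> K closure_of W = {}"
    and no: "never_joined \<Omega> V W"
    using vis unfolding seq_visible_def by (elim exE conjE)
  obtain C where C: "\<And>n. compact (C n)" "\<And>n. C n \<subseteq> \<Omega>"
    and Cabs: "\<And>K. \<lbrakk>compact K; K \<subseteq> \<Omega>\<rbrakk> \<Longrightarrow> \<exists>N::nat. \<forall>n\<ge>N. K \<subseteq> C n"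
    using open_Union_compact_subsets[OF \<Omega>] by metis
  have "\<exists>T\<ge>0. \<exists>\<sigma>. almost_geodesic \<Omega> \<Lambda> \<kappa> {0..T} \<sigma> \<and> Pt (\<sigma> 0) \<in> V \<and> Pt (\<sigma> T) \<in> W \<and> \<sigma> ` {0..T} \<inter> C n = {}" for n
  proof (rule ccontr)
    assume "\<not> ?thesis"
    then have H: "\<forall>T\<ge>0. \<forall>\<sigma>. almost_geodesic \<Omega> \<Lambda> \<kappa> {0..T} \<sigma> \<and> Pt (\<sigma> 0) \<in> V \<and> Pt (\<sigma> T) \<in> W \<longrightarrow>
        \<sigma> ` {0..T} \<inter> C n \<noteq> {}" by blast
    have "visible_pair \<Omega> K \<Lambda> \<kappa> \<zeta> \<eta>"
      unfolding visible_pair_def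
      by (rule exI[of _ V], rule exI[of _ W], rule exI[of _ "C n"], intro conjI * C H)
    then show False using nvis by blast
  qed
  then obtain T \<sigma> where T: "\<And>n. 0 \<le> T n" "\<And>n. almost_geodesic \<Omega> \<Lambda> \<kappa> {0..T n} (\<sigma> n)"
    "\<And>n. Pt (\<sigma> n 0) \<in> V" "\<And>n. Pt (\<sigma> n (T n)) \<in> W" "\<And>n. \<sigma> n ` {0..T n} \<inter> C n = {}"
    by metis
  have "escaping \<Omega> \<sigma> T"
    unfolding escaping_def
  proof (intro allI impI)
    fix D assume "compact D \<and> D \<subseteq> \<Omega>"
    then obtain N where N: "\<And>n. n \<ge> N \<Longrightarrow> D \<subseteq> C n" using Cabs by blast
    show "\<forall>\<^sub>F n in sequentially. \<sigma> n ` {0..T n} \<inter> D = {}"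
      using eventually_ge_at_top[of N]
    proof eventually_elim
      case (elim n)
      then show ?case using N[of n] T(5)[of n] by blast
    qed
  qed
  then show False
    using no[unfolded never_joined_def, rule_format, of \<Lambda> \<kappa> T \<sigma> "\<lambda>n. 0" T] T \<Lambda> by simp
qed

section \<open>Separation of pairs of boundary points\<close>

lemma closure_of_meets:
  "x \<in> Z closure_of A \<Longrightarrow> openin Z T \<Longrightarrow> x \<in> T \<Longrightarrow> \<exists>y. y \<in> A \<and> y \<in> T"
  by (simp add: in_closure_of)

locale condition2_domain =
  fixes \<Omega> S :: "complex set" and K :: "nat \<Rightarrow> complex set"
  assumes \<Omega>: "open \<Omega>" "connected \<Omega>" and S: "closed S" "totally_disconnected S"
    and c2: "p \<in> frontier \<Omega> - S \<Longrightarrow> condition2_at \<Omega> p"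
    and K: "compact_exhaustion (closure \<Omega>) K"
begin

lemma no_escape:
  assumes "1 \<le> \<Lambda>" "\<forall>n. almost_geodesic \<Omega> \<Lambda> \<kappa> {0..T n} (\<sigma> n)" "escaping \<Omega> \<sigma> T"
    "\<And>n. t n \<in> {0..T n}" "\<And>n. s n \<in> {0..T n}"
    "compact A" "\<And>n. \<sigma> n (t n) \<in> A" "0 < e" "\<And>n a. a \<in> A \<Longrightarrow> e \<le> dist a (\<sigma> n (s n))"
  shows False
  using no_escape_between[OF \<Omega>(1) S c2 assms(1) assms(2)[rule_format] assms(3-9)] by blast

abbreviation "X \<equiv> end_topology \<Omega> K"

lemma closedin_Pt_compact:
  assumes "compact C" "C \<subseteq> closure \<Omega>"
  shows "closedin X (Pt ` C)"
  using end_open_compact_complement[OF K assms] assms(2)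
  unfolding closedin_def topspace_end_topology by (auto simp: end_carrier_def)

lemma seq_visible_Pt_Pt:
  assumes ab: "a \<in> closure \<Omega>" "b \<in> closure \<Omega>" "a \<noteq> b"
  shows "seq_visible \<Omega> K (Pt a) (Pt b)"
proof -
  \<comment> \<open>With a third of the distance, the two closed balls are still \<open>r\<close>
    apart.\<close>
  define r where "r = dist a b / 3"
  have r: "r > 0" using ab by (simp add: r_def)
  define N where "N c = Pt ` (closure \<Omega> \<inter> cball c r)" for c
  have sub: "N c \<subseteq> end_carrier \<Omega> K" for c by (auto simp: N_def end_carrier_def)
  have far: "r \<le> dist x y" if "x \<in> cball a r" "y \<in> cball b r" for x y
    using that dist_triangle[of a b x] dist_triangle[of x b y] by (simp add: r_def dist_commute)
  have int: "Pt c \<in> X interior_of N c" if "c \<in> closure \<Omega>" for c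
  proof -
    have "openin X (Pt ` (closure \<Omega> \<inter> ball c r))" by (intro end_open_Pt_image openin_open_Int) simp
    moreover have "Pt ` (closure \<Omega> \<inter> ball c r) \<subseteq> N c" by (auto simp: N_def)
    moreover have "Pt c \<in> Pt ` (closure \<Omega> \<inter> ball c r)" using that r by simp
    ultimately show ?thesis unfolding interior_of_def by blast
  qed
  have cl: "X closure_of N c = N c" for c
    unfolding N_def by (intro closure_of_closedin closedin_Pt_compact closed_Int_compact) auto
  have "X closure_of N a \<inter> X closure_of N b = {}"
      unfolding cl using far r by (force simp: N_def)
  moreover have "never_joined \<Omega> (N a) (N b)"
    unfolding never_joined_def
  proof (intro allI impI)
    fix \<Lambda> \<kappa> :: real and \<sigma> :: "nat \<Rightarrow> real \<Rightarrow> complex" and T t s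
    assume *: "1 \<le> \<Lambda>" "\<forall>n::nat. almost_geodesic \<Omega> \<Lambda> \<kappa> {0..T n} (\<sigma> n)" "escaping \<Omega> \<sigma> T"
      and ts: "\<forall>n. t n \<in> {0..T n}" "\<forall>n. s n \<in> {0..T n}" "\<forall>n. Pt (\<sigma> n (t n)) \<in> N a" "\<forall>n. Pt (\<sigma> n (s n)) \<in> N b"
    show False
    proof (rule no_escape[OF *, of t s "cball a r" r])
      show "\<sigma> n (t n) \<in> cball a r" for n using ts by (auto simp: N_def)
      show "r \<le> dist x (\<sigma> n (s n))" if "x \<in> cball a r" for n x
        using ts(4)[rule_format, of n] far[OF that, of "\<sigma> n (s n)"] by (auto simp: N_def)
    qed (use ts r in auto)
  qed
  ultimately show ?thesis using sub int ab unfolding seq_visible_def by blast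
qed

lemma seq_visible_Pt_End:
  assumes a: "a \<in> closure \<Omega>" and G: "G \<in> ends \<Omega> K"
  shows "seq_visible \<Omega> K (Pt a) (End G)"
proof -
  define V where "V = Pt ` (closure \<Omega> \<inter> cball a 1)"
  \<comment> \<open>Removing the open ball makes \<open>W\<close> closed, while removing the closed
    ball of the same radius leaves an open neighbourhood of every end inside it. The radii 1 and 2
    leave a gap of 1.\<close>
  define W where "W = end_carrier \<Omega> K - Pt ` (closure \<Omega> \<inter> ball a 2)"
  have sub: "V \<subseteq> end_carrier \<Omega> K" "W \<subseteq> end_carrier \<Omega> K" by (auto simp: V_def W_def end_carrier_def)
  have clV: "X closure_of V = V"
    unfolding V_def by (intro closure_of_closedin closedin_Pt_compact closed_Int_compact) auto
  have "openin X (Pt ` (closure \<Omega> \<inter> ball a 2))" by (intro end_open_Pt_image openin_open_Int) simp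
  then have clW: "X closure_of W = W"
    unfolding W_def topspace_end_topology[symmetric] by (intro closure_of_closedin closedin_diff closedin_topspace)
  have intV: "Pt a \<in> X interior_of V"
  proof -
    have "openin X (Pt ` (closure \<Omega> \<inter> ball a 1))" by (intro end_open_Pt_image openin_open_Int) simp
    moreover have "Pt ` (closure \<Omega> \<inter> ball a 1) \<subseteq> V" by (auto simp: V_def)
    moreover have "Pt a \<in> Pt ` (closure \<Omega> \<inter> ball a 1)" using a by simp
    ultimately show ?thesis unfolding interior_of_def by blast
  qed
  have intW: "End G \<in> X interior_of W"
  proof -
    have "openin X (end_carrier \<Omega> K - Pt ` (closure \<Omega> \<inter> cball a 2))"
      by (intro end_open_compact_complement[OF K] closed_Int_compact) auto
    moreover have "end_carrier \<Omega> K - Pt ` (closure \<Omega> \<inter> cball a 2) \<subseteq> W" by (auto simp: W_def)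
    moreover have "End G \<in> end_carrier \<Omega> K - Pt ` (closure \<Omega> \<inter> cball a 2)" using G by (auto simp: end_carrier_def)
    ultimately show ?thesis unfolding interior_of_def by blast
  qed
  have "X closure_of V \<inter> X closure_of W = {}" unfolding clV clW by (auto simp: V_def W_def)
  moreover have "never_joined \<Omega> V W"
    unfolding never_joined_def
  proof (intro allI impI)
    fix \<Lambda> \<kappa> :: real and \<sigma> :: "nat \<Rightarrow> real \<Rightarrow> complex" and T t s
    assume *: "1 \<le> \<Lambda>" "\<forall>n::nat. almost_geodesic \<Omega> \<Lambda> \<kappa> {0..T n} (\<sigma> n)" "escaping \<Omega> \<sigma> T"
      and ts: "\<forall>n. t n \<in> {0..T n}" "\<forall>n. s n \<in> {0..T n}" "\<forall>n. Pt (\<sigma> n (t n)) \<in> V" "\<forall>n. Pt (\<sigma> n (s n)) \<in> W"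
    show False
    proof (rule no_escape[OF *, of t s "cball a 1" 1])
      show "\<sigma> n (t n) \<in> cball a 1" for n using ts by (auto simp: V_def)
      show "1 \<le> dist x (\<sigma> n (s n))" if "x \<in> cball a 1" for n x
      proof -
        have "Pt (\<sigma> n (s n)) \<in> W" using ts by blast
        then have "2 \<le> dist a (\<sigma> n (s n))" by (auto simp: W_def end_carrier_def image_iff not_less)
        then show ?thesis using that dist_triangle[of a "\<sigma> n (s n)" x] by simp
      qed
    qed (use ts in auto)
  qed
  ultimately show ?thesis using sub intV intW unfolding seq_visible_def by blast
qed

text \<open>At a level \<open>j\<close> where the ends differ, a curve between the two components
  must cross the compact set \<open>K j\<close>, which is far from both neighbourhoods; so the
  compact case applies with \<open>A = K j\<close>.\<close>

lemma seq_visible_End_End: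
  assumes F: "F \<in> ends \<Omega> K" and G: "G \<in> ends \<Omega> K" and FG: "F \<noteq> G"
  shows "seq_visible \<Omega> K (End F) (End G)"
proof -
  have op: "openin (top_of_set (closure \<Omega>)) C" if "C \<in> components (closure \<Omega> - K j)" for C j
    using components_closure_diff_openin[OF \<Omega> S c2 _ that] K unfolding compact_exhaustion_def by blast
  have anti: "F' (Suc i) \<subseteq> F' i" if "F' \<in> ends \<Omega> K" for F' i
    using that by (auto simp: ends_def split: if_splits)
  obtain j where j: "F j \<noteq> G j" using FG by (auto simp: fun_eq_iff)
  have comp: "F j \<in> components (closure \<Omega> - K j)" "G j \<in> components (closure \<Omega> - K j)"
    using end_in_components F G by blast+
  \<comment> \<open>One level beyond \<open>j\<close>: the components at level \<open>Suc j\<close>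
    avoid a neighbourhood of \<open>K j\<close>, so their closures avoid \<open>K j\<close>. At
    level \<open>j\<close> both closures could meet there.\<close>
  define V where "V = end_nhd \<Omega> K F (Suc j)"
  define W where "W = end_nhd \<Omega> K G (Suc j)"
  obtain Q where Q: "open Q" "K j \<subseteq> Q" "closure \<Omega> \<inter> Q \<subseteq> K (Suc j)"
    using compact_exhaustion_nhd[OF K] by blast
  \<comment> \<open>\<open>F' (Suc j)\<close> lies in \<open>F' j\<close>, so a component of level
    \<open>j\<close> that meets it can only be \<open>F' j\<close>.\<close>
  have meets: "H = F' j" if H: "H \<in> components (closure \<Omega> - K j)" and F': "F' \<in> ends \<Omega> K"
    and y: "y \<in> H" "y \<in> F' (Suc j)" for H F' y
    using components_eq[OF H end_in_components[OF F']] y anti[OF F'] by blast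
  have cl_Pt: "z \<in> closure \<Omega> - K j \<and> (\<forall>H \<in> components (closure \<Omega> - K j). z \<in> H \<longrightarrow> H = F' j)"
    if F': "F' \<in> ends \<Omega> K" and z: "Pt z \<in> X closure_of end_nhd \<Omega> K F' (Suc j)" for F' z
  proof (intro conjI ballI impI DiffI)
    have "Pt z \<in> end_carrier \<Omega> K" using z closure_of_subset_topspace[of X] topspace_end_topology by blast
    then show z\<Omega>: "z \<in> closure \<Omega>" by (auto simp: end_carrier_def)
    show "z \<notin> K j"
    proof
      assume "z \<in> K j"
      then have zQ: "Pt z \<in> Pt ` (closure \<Omega> \<inter> Q)" using z\<Omega> Q by blast
      have oQ: "openin X (Pt ` (closure \<Omega> \<inter> Q))" by (intro end_open_Pt_image openin_open_Int Q)
      obtain y where "y \<in> end_nhd \<Omega> K F' (Suc j)" "y \<in> Pt ` (closure \<Omega> \<inter> Q)"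
        using closure_of_meets[OF z oQ zQ] by blast
      then have "\<exists>x. x \<in> F' (Suc j) \<and> x \<in> closure \<Omega> \<inter> Q" by (auto simp: end_nhd_def)
      then show False using Q(3) in_components_subset[OF end_in_components[OF F', of "Suc j"]] by blast
    qed
    fix H assume H: "H \<in> components (closure \<Omega> - K j)" "z \<in> H"
    have oH: "openin X (Pt ` H)" using op[OF H(1)] by (rule end_open_Pt_image)
    obtain y where "y \<in> end_nhd \<Omega> K F' (Suc j)" "y \<in> Pt ` H"
      using closure_of_meets[OF z oH imageI[OF H(2)]] by blast
    then show "H = F' j" using meets[OF H(1) F'] by (auto simp: end_nhd_def)
  qed
  have cl_End: "H j = F' j"
    if F': "F' \<in> ends \<Omega> K" and z: "End H \<in> X closure_of end_nhd \<Omega> K F' (Suc j)" for F' H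
  proof -
    have "End H \<in> end_carrier \<Omega> K" using z closure_of_subset_topspace[of X] topspace_end_topology by blast
    then have H: "H \<in> ends \<Omega> K" by (auto simp: end_carrier_def)
    have oH: "openin X (end_nhd \<Omega> K H j)" using end_open_end_nhd[OF H op[OF end_in_components[OF H]]] .
    have HH: "End H \<in> end_nhd \<Omega> K H j" using H by (auto simp: end_nhd_def)
    obtain y where y: "y \<in> end_nhd \<Omega> K F' (Suc j)" "y \<in> end_nhd \<Omega> K H j"
      using closure_of_meets[OF z oH HH] by blast
    show ?thesis
    proof (cases y)
      case (Pt x)
      then have "x \<in> F' (Suc j)" "x \<in> H j" using y by (auto simp: end_nhd_def)
      then show ?thesis using meets[OF end_in_components[OF H] F'] by blast
    next
      case (End L)
      then have "L j = F' j" "L j = H j" using y by (auto simp: end_nhd_def)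
      then show ?thesis by simp
    qed
  qed
  have int: "End F' \<in> X interior_of end_nhd \<Omega> K F' (Suc j)" if F': "F' \<in> ends \<Omega> K" for F'
  proof -
    have "openin X (end_nhd \<Omega> K F' (Suc j))" using end_open_end_nhd[OF F' op[OF end_in_components[OF F']]] .
    then have "X interior_of end_nhd \<Omega> K F' (Suc j) = end_nhd \<Omega> K F' (Suc j)" by (simp add: interior_of_openin)
    then show ?thesis using F' by (simp add: end_nhd_def)
  qed
  have sub: "V \<subseteq> end_carrier \<Omega> K" "W \<subseteq> end_carrier \<Omega> K"
      unfolding V_def W_def using end_nhd_subset_carrier F G by blast+
  have ints: "End F \<in> X interior_of V" "End G \<in> X interior_of W" unfolding V_def W_def using int F G by blast+
  have cl: "X closure_of V \<inter> X closure_of W = {}"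
    proof (rule equals0I)
      fix y assume y: "y \<in> X closure_of V \<inter> X closure_of W"
      show False
      proof (cases y)
        case (Pt z)
        then have z: "Pt z \<in> X closure_of end_nhd \<Omega> K F (Suc j)" "Pt z \<in> X closure_of end_nhd \<Omega> K G (Suc j)"
          using y by (auto simp: V_def W_def)
        have "z \<in> \<Union>(components (closure \<Omega> - K j))" using cl_Pt[OF F z(1)] by simp
        then obtain H where "H \<in> components (closure \<Omega> - K j)" "z \<in> H" by blast
        then show False using cl_Pt[OF F z(1)] cl_Pt[OF G z(2)] j by metis
      next
        case (End H)
        then show False using cl_End[OF F, of H] cl_End[OF G, of H] y j by (auto simp: V_def W_def)
      qed
    qed
  have "never_joined \<Omega> V W"
    unfolding never_joined_def
  proof (intro allI impI)
    fix \<Lambda> \<kappa> :: real and \<sigma> :: "nat \<Rightarrow> real \<Rightarrow> complex" and T t s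
    assume *: "1 \<le> \<Lambda>" "\<forall>n::nat. almost_geodesic \<Omega> \<Lambda> \<kappa> {0..T n} (\<sigma> n)" "escaping \<Omega> \<sigma> T"
      and ts: "\<forall>n. t n \<in> {0..T n}" "\<forall>n. s n \<in> {0..T n}" "\<forall>n. Pt (\<sigma> n (t n)) \<in> V" "\<forall>n. Pt (\<sigma> n (s n)) \<in> W"
    have tF: "\<sigma> n (t n) \<in> F (Suc j)" and sG: "\<sigma> n (s n) \<in> G (Suc j)" for n
      using ts by (auto simp: V_def W_def end_nhd_def)
    \<comment> \<open>A connected curve that misses \<open>K j\<close> would stay in one component
      of level \<open>j\<close>.\<close>
    have "\<exists>c\<in>{0..T n}. \<sigma> n c \<in> K j" for n
    proof (rule ccontr)
      assume no: "\<not> ?thesis"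
      have ag: "almost_geodesic \<Omega> \<Lambda> \<kappa> {0..T n} (\<sigma> n)" using * by blast
      have "continuous_on {0..T n} (\<sigma> n)"
        using ag[unfolded almost_geodesic_def] is_interval_cc
        by (intro absolutely_continuous_on_imp_continuous_on) auto
      then have "connected (\<sigma> n ` {0..T n})" by (intro connected_continuous_image) auto
      moreover have "\<sigma> n ` {0..T n} \<subseteq> closure \<Omega> - K j"
        using no ag[unfolded almost_geodesic_def, THEN conjunct2, THEN conjunct1] closure_subset[of \<Omega>] by blast
      moreover have tj: "\<sigma> n (t n) \<in> F j" "\<sigma> n (s n) \<in> G j" using tF[of n] sG[of n] anti F G by blast+
      moreover have "\<sigma> n (t n) \<in> \<sigma> n ` {0..T n}" "\<sigma> n (s n) \<in> \<sigma> n ` {0..T n}" using ts by blast+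
      ultimately have "\<sigma> n ` {0..T n} \<subseteq> F j"
        using components_maximal[OF comp(1), of "\<sigma> n ` {0..T n}"] by blast
      then have "\<sigma> n (s n) \<in> F j" using ts by blast
      then show False using tj(2) components_eq[OF comp] j by blast
    qed
    then obtain c where c: "\<And>n. c n \<in> {0..T n}" "\<And>n. \<sigma> n (c n) \<in> K j" by metis
    have cK: "compact (K j)" using K unfolding compact_exhaustion_def by blast
    \<comment> \<open>\<open>closure \<Omega> - Q\<close> is closed, disjoint from
      \<open>K j\<close>, and contains \<open>G (Suc j)\<close>; this gives the uniform gap between
      the crossing points and the far points.\<close>
    obtain e where e: "0 < e" "\<And>x y. x \<in> K j \<Longrightarrow> y \<in> closure \<Omega> - Q \<Longrightarrow> e \<le> dist x y"
      using separate_compact_closed[OF cK closed_Diff[OF closed_closure Q(1)]] Q(2) by blast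
    have sQ: "\<sigma> n (s n) \<in> closure \<Omega> - Q" for n
      using sG[of n] Q(3) in_components_subset[OF end_in_components[OF G, of "Suc j"]] by blast
    show False
      by (rule no_escape[OF *, of c s "K j" e]) (use c ts e sQ cK in auto)
  qed
  then show ?thesis using sub ints cl unfolding seq_visible_def by blast
qed

lemma seq_visible_boundary:
  assumes "\<zeta> \<in> end_boundary \<Omega> K" "\<eta> \<in> end_boundary \<Omega> K" "\<zeta> \<noteq> \<eta>"
  shows "seq_visible \<Omega> K \<zeta> \<eta>"
proof (cases \<zeta>; cases \<eta>)
qed (use assms in \<open>auto simp: end_boundary_def end_carrier_def
    intro: seq_visible_Pt_Pt seq_visible_Pt_End seq_visible_End_End seq_visible_sym[OF seq_visible_Pt_End]\<close>)

end

theorem theorem4p3: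
  fixes \<Omega> :: "complex set"
  assumes "hyperbolic_domain \<Omega>" and "condition2 \<Omega>"
  shows "visibility_domain \<Omega>"
proof -
  obtain S where S: "closed S" "totally_disconnected S" "\<And>p. p \<in> frontier \<Omega> - S \<Longrightarrow> condition2_at \<Omega> p"
    using assms(2) unfolding condition2_iff by blast
  have \<Omega>: "open \<Omega>" "connected \<Omega>" using assms(1) unfolding hyperbolic_domain_def by blast+
  show ?thesis
    unfolding visibility_domain_def
  proof (intro conjI allI impI ballI assms(1))
    fix K and \<Lambda> \<kappa> :: real and \<zeta> \<eta>
    assume K: "compact_exhaustion (closure \<Omega>) K" and \<Lambda>: "1 \<le> \<Lambda>"
      and *: "\<zeta> \<in> end_boundary \<Omega> K" "\<eta> \<in> end_boundary \<Omega> K" "\<zeta> \<noteq> \<eta>"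
    interpret condition2_domain \<Omega> S K
      using \<Omega> S K by unfold_locales auto
    show "visible_pair \<Omega> K \<Lambda> \<kappa> \<zeta> \<eta>"
      using seq_visible_imp_visible_pair[OF \<Omega>(1) seq_visible_boundary[OF *] \<Lambda>] .
  qed
qed

end
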